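(* Let $p,q>1$ be integers with $\frac{\log p}{\log q}$ irrational. When the spaces of measures are equipped with weak-$*$ topologies, the restriction map $R:M_{p,q}(S_{pq})\to M_{p,q}(\mathbb{T})$ defined by $R(\mu)(f)=\mu(f)$ for $\mu\in M_{p,q}(S_{pq})$ and $f\in C(\mathbb{T})\subset C(S_{pq})$ is a homeomorphism. Also, $R$ restricts to a homeomorphism from $EM_{p,q}(S_{pq})$ to $EM_{p,q}(\mathbb{T})$.
   Context: $\mathbb{T}$ is the unit circle with maps $T_p(z)=z^p$, $T_q(z)=z^q$. $S_{pq}$ is the Pontryagin dual of the discrete group $\mathbb{Z}[\frac1{pq}]$; the automorphisms $g\mapsto pg$ and $g\mapsto qg$ of $\mathbb{Z}[\frac1{pq}]$ induce automorphisms of $S_{pq}$, also called the $\times p,\times q$ maps and denoted $T_p,T_q$. For a measure $\mu$, $\mu(f)=\int f\,d\mu$. $C(\mathbb{T})=C^*(\mathbb{Z})$ is regarded as a $C^*$-subalgebra of $C(S_{pq})=C^*(\mathbb{Z}[\frac1{pq}])$ via the inclusion $\mathbb{Z}\subset\mathbb{Z}[\frac1{pq}]$ (equivalently, via the dual surjection $S_{pq}\to\mathbb{T}$). For $Y=\mathbb{T}$ or $S_{pq}$: a Borel probability measure $\mu$ on $Y$ is $\times p,\times q$-invariant if $\mu(T_p^{-1}E)=\mu(T_q^{-1}E)=\mu(E)$ for every Borel $E\subset Y$; such $\mu$ is ergodic if every Borel $E$ with $T_p^{-1}E=E=T_q^{-1}E$ satisfies $\mu(E)\in\{0,1\}$.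 $M_{p,q}(Y)$ is the set of $\times p,\times q$-invariant Borel probability measures on $Y$ and $EM_{p,q}(Y)$ its subset of ergodic ones. *)

theory Defs
  imports "HOL-Probability.Probability"
begin

definition borel_algebra :: "'a topology \<Rightarrow> 'a measure" where
  "borel_algebra Y = sigma (topspace Y) {U. openin Y U}"

definition borel_prob_measures :: "'a topology \<Rightarrow> 'a measure set" where
  "borel_prob_measures Y = {\<mu>. sets \<mu> = sets (borel_algebra Y) \<and> prob_space \<mu>}"

definition invariant_measures ::
    "'a topology \<Rightarrow> ('a \<Rightarrow> 'a) \<Rightarrow> ('a \<Rightarrow> 'a) \<Rightarrow> 'a measure set" where
  "invariant_measures Y S T = {\<mu> \<in> borel_prob_measures Y. \<forall>E \<in> sets (borel_algebra Y).
     measure \<mu> (S -` E \<inter> topspace Y) = measure \<mu> E \<and>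
     measure \<mu> (T -` E \<inter> topspace Y) = measure \<mu> E}"

definition ergodic_measures ::
    "'a topology \<Rightarrow> ('a \<Rightarrow> 'a) \<Rightarrow> ('a \<Rightarrow> 'a) \<Rightarrow> 'a measure set" where
  "ergodic_measures Y S T = {\<mu> \<in> invariant_measures Y S T. \<forall>E \<in> sets (borel_algebra Y).
     S -` E \<inter> topspace Y = E \<and> T -` E \<inter> topspace Y = E \<longrightarrow> measure \<mu> E \<in> {0, 1}}"

(* Elements are total functions; their values outside topspace Y are irrelevant, since
   they are only integrated against measures whose space is topspace Y. *)
definition cont_functions :: "'a topology \<Rightarrow> ('a \<Rightarrow> complex) set" where
  "cont_functions Y = {f. continuous_map Y euclidean f}"

(* The coarsest topology on the Borel probability measures on Y for which
   \<mu> \<mapsto> \<mu>(f) is continuous for every f in C(Y). *)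
definition weak_star :: "'a topology \<Rightarrow> 'a measure topology" where
  "weak_star Y = pullback_topology (borel_prob_measures Y)
     (\<lambda>\<mu>. \<lambda>f\<in>cont_functions Y. integral\<^sup>L \<mu> f)
     (product_topology (\<lambda>_. euclidean) (cont_functions Y))"

definition circle :: "complex topology" where
  "circle = top_of_set (sphere 0 1)"

(* Pontryagin dual of a subgroup A of an ambient abelian group, A being discrete: the
   compact-open topology on characters is then that of pointwise convergence.  Characters
   are extensional, i.e. undefined outside A. *)
definition discrete_dual :: "'a::ab_group_add set \<Rightarrow> ('a \<Rightarrow> complex) topology" where
  "discrete_dual A = subtopology (product_topology (\<lambda>_. circle) A)
     {\<phi>. \<forall>g\<in>A. \<forall>h\<in>A. \<phi> (g + h) = \<phi> g * \<phi> h}"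

definition Z_inv :: "nat \<Rightarrow> rat set" where
  "Z_inv m = {of_int a / of_nat m ^ n | (a::int) (n::nat). True}"

definition solenoid :: "nat \<Rightarrow> nat \<Rightarrow> (rat \<Rightarrow> complex) topology" where
  "solenoid p q = discrete_dual (Z_inv (p * q))"

(* The map on the dual of Z[1/(pq)] induced by g \<mapsto> k g, for k = p or k = q. *)
definition solenoid_times :: "nat \<Rightarrow> nat \<Rightarrow> nat \<Rightarrow> (rat \<Rightarrow> complex) \<Rightarrow> (rat \<Rightarrow> complex)" where
  "solenoid_times p q k \<phi> = (\<lambda>g\<in>Z_inv (p * q). \<phi> (of_nat k * g))"

definition M_circle :: "nat \<Rightarrow> nat \<Rightarrow> complex measure set" where
  "M_circle p q = invariant_measures circle (\<lambda>z. z ^ p) (\<lambda>z. z ^ q)"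

definition EM_circle :: "nat \<Rightarrow> nat \<Rightarrow> complex measure set" where
  "EM_circle p q = ergodic_measures circle (\<lambda>z. z ^ p) (\<lambda>z. z ^ q)"

definition M_solenoid :: "nat \<Rightarrow> nat \<Rightarrow> (rat \<Rightarrow> complex) measure set" where
  "M_solenoid p q =
     invariant_measures (solenoid p q) (solenoid_times p q p) (solenoid_times p q q)"

definition EM_solenoid :: "nat \<Rightarrow> nat \<Rightarrow> (rat \<Rightarrow> complex) measure set" where
  "EM_solenoid p q =
     ergodic_measures (solenoid p q) (solenoid_times p q p) (solenoid_times p q q)"

(* The inclusion of C(circle) in C(solenoid).  Restricting characters of Z[1/(pq)] to Z, and
   identifying a character of Z with its value at 1, the dual surjection is \<phi> \<mapsto> \<phi> 1. *)
definition cont_embed :: "(complex \<Rightarrow> complex) \<Rightarrow> ((rat \<Rightarrow> complex) \<Rightarrow> complex)" where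
  "cont_embed f = (\<lambda>\<phi>. f (\<phi> 1))"

(* R \<mu> is the measure determined by (R \<mu>)(f) = \<mu>(f) for f in C(circle). *)
definition restriction_map :: "nat \<Rightarrow> nat \<Rightarrow> (rat \<Rightarrow> complex) measure \<Rightarrow> complex measure" where
  "restriction_map p q \<mu> = (THE \<nu>. \<nu> \<in> M_circle p q \<and>
     (\<forall>f\<in>cont_functions circle. integral\<^sup>L \<nu> f = integral\<^sup>L \<mu> (cont_embed f)))"

end

(*
A point of the solenoid S is determined by its coordinates phi(1/m^n), m = pq, and the m-th power
of each coordinate is the previous one.  Since multiplication by m = pq on S carries the n-th
coordinate to the previous one, an invariant measure gives all coordinates the same law nu,
namely its image on the circle.  By Stone-Weierstrass the functions of a single coordinate are
dense in C(S), so nu determines the measure, and weak-* continuously; conversely the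
finite-dimensional laws prescribed by an invariant nu are consistent, and Kolmogorov's theorem
yields a measure on S above it.
For ergodicity, let E be an invariant set of positive measure in S with ergodic image nu.
The measure conditioned on E is invariant and its image is absolutely continuous with respect
to nu, hence equal to nu; by injectivity conditioning on E changes nothing, so E has full measure.
*)
theory Submission
  imports Defs
begin

section \<open>Borel measures and the weak-* topology\<close>

text \<open>Any two coordinates are powers of one further along. This makes the functions of a
  single coordinate an algebra, and it lets the law of one coordinate prescribe every
  finite-dimensional law. Three obstacles shape the proof. Kolmogorov's theorem gives a measure on
  all functions from the rationals to the complex numbers, so concentration on the solenoid must be
  proved; since the rationals are countable, it amounts to countably many conditions on finitely
  many coordinates each. Ergodicity speaks of strictly invariant sets, while a comparison of
  densities yields sets invariant only up to null sets; recurrence along orbits bridges the gap.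
  Finally, continuity of the inverse has to be uniform in the measure: for f in C(S) an
  approximating function h of one coordinate is fixed before the measure is, so the functional
  attached to f is a uniform limit of functionals that integrate a continuous function on the
  circle.\<close>

lemma sets_borel_algebra:
  "sets (borel_algebra (top_of_set K)) = sets (restrict_space borel K)"
proof -
  have "sets (borel_algebra (top_of_set K)) = sigma_sets K {U. openin (top_of_set K) U}"
    unfolding borel_algebra_def by (subst sets_measure_of) (use openin_subset in fastforce)+
  also have "{U. openin (top_of_set K) U} = {id -` A \<inter> K | A. A \<in> {S. open S}}"
    by (auto simp: openin_open)
  also have "sigma_sets K \<dots> = {id -` A \<inter> K | A. A \<in> sigma_sets UNIV {S. open S}}"
    by (rule sigma_sets_vimage_commute[symmetric]) auto
  also have "\<dots> = sets (restrict_space borel K)"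
    by (auto simp: sets_restrict_space borel_def)
  finally show ?thesis .
qed

lemma borel_prob_measures_top_of_set:
  "\<mu> \<in> borel_prob_measures (top_of_set K) \<longleftrightarrow>
     sets \<mu> = sets (restrict_space borel K) \<and> prob_space \<mu>"
  by (simp add: borel_prob_measures_def sets_borel_algebra)

lemma cont_functions_top_of_set: "f \<in> cont_functions (top_of_set K) \<longleftrightarrow> continuous_on K f"
  by (simp add: cont_functions_def)

lemma borel_prob_integrable:
  fixes f :: "'a::metric_space \<Rightarrow> 'b::{banach, second_countable_topology}"
  assumes "compact K" "\<mu> \<in> borel_prob_measures (top_of_set K)" "continuous_on K f"
  shows "integrable \<mu> f"
proof -
  have s: "sets \<mu> = sets (restrict_space borel K)" and "prob_space \<mu>"
    using assms(2) by (auto simp: borel_prob_measures_top_of_set)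
  interpret prob_space \<mu> by fact
  have sp: "space \<mu> = K" using sets_eq_imp_space_eq[OF s] by (simp add: space_restrict_space)
  have "f \<in> borel_measurable \<mu>"
    using borel_measurable_continuous_on_restrict[OF assms(3)] measurable_cong_sets[OF s refl] by blast
  moreover have "bounded (f ` K)"
    using assms(1,3) compact_continuous_image compact_imp_bounded by blast
  then obtain B where "\<And>x. x \<in> K \<Longrightarrow> norm (f x) \<le> B" by (auto simp: bounded_iff)
  ultimately show ?thesis
    by (intro integrable_const_bound[where B=B]) (auto simp: sp)
qed

lemma borel_prob_eqI:
  fixes K :: "'a::metric_space set"
  assumes K: "compact K"
    and M: "\<mu> \<in> borel_prob_measures (top_of_set K)" "\<nu> \<in> borel_prob_measures (top_of_set K)"
    and eq: "\<And>f :: 'a \<Rightarrow> complex. continuous_on K f \<Longrightarrow> integral\<^sup>L \<mu> f = integral\<^sup>L \<nu> f"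
  shows "\<mu> = \<nu>"
proof -
  have s: "sets \<rho> = sets (restrict_space borel K)" "prob_space \<rho>" "space \<rho> = K"
    if "\<rho> \<in> borel_prob_measures (top_of_set K)" for \<rho>
    using that sets_eq_imp_space_eq[of \<rho> "restrict_space borel K"]
    by (auto simp: borel_prob_measures_top_of_set space_restrict_space)
  have clK: "closed K" by (simp add: K compact_imp_closed)
  define \<E> where "\<E> = {C. closed C \<and> C \<subseteq> K}"
  have bor: "sets borel = sigma_sets UNIV {S::'a set. closed S}"
    by (subst borel_eq_closed) simp
  have gen: "sets (restrict_space borel K) = sigma_sets K \<E>"
  proof -
    have "sets (restrict_space borel K) = {id -` A \<inter> K | A. A \<in> sigma_sets UNIV {S::'a set. closed S}}"
      by (auto simp: sets_restrict_space bor)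
    also have "\<dots> = sigma_sets K {id -` A \<inter> K | A. A \<in> {S. closed S}}"
      by (rule sigma_sets_vimage_commute) auto
    also have "{id -` A \<inter> K | A. A \<in> {S. closed S}} = \<E>"
      unfolding \<E>_def using clK by force
    finally show ?thesis .
  qed
  \<comment> \<open>For closed nonempty \<open>C\<close> these tent functions decrease to the
    indicator of \<open>C\<close>, so integrals of continuous functions determine the measure of
    \<open>C\<close>.\<close>
  define g :: "'a set \<Rightarrow> nat \<Rightarrow> 'a \<Rightarrow> complex" where
    "g C n x = complex_of_real (max 0 (1 - real n * infdist x C))" for C n x
  have lim: "(\<lambda>n. integral\<^sup>L \<rho> (g C n)) \<longlonglongrightarrow> complex_of_real (measure \<rho> C)"
    if \<rho>: "\<rho> \<in> borel_prob_measures (top_of_set K)" and C: "closed C" "C \<subseteq> K" "C \<noteq> {}" for \<rho> C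
  proof -
    interpret prob_space \<rho> using s[OF \<rho>] by simp
    have Cs: "C \<in> sets \<rho>" using C s(1)[OF \<rho>] clK by (auto simp: sets_restrict_space_iff)
    have "(\<lambda>n. integral\<^sup>L \<rho> (g C n)) \<longlonglongrightarrow> (\<integral>x. complex_of_real (indicator C x) \<partial>\<rho>)"
    proof (rule integral_dominated_convergence[where w="\<lambda>_. 1"])
      show "(\<lambda>x. complex_of_real (indicator C x)) \<in> borel_measurable \<rho>" using Cs by simp
      have "continuous_on K (g C n)" for n
        unfolding g_def by (intro continuous_intros)
      from borel_prob_integrable[OF K \<rho> this]
      show "g C n \<in> borel_measurable \<rho>" for n by auto
      show "AE x in \<rho>. norm (g C n x) \<le> 1" for n
        by (auto simp: g_def infdist_nonneg)
      show "AE x in \<rho>. (\<lambda>n. g C n x) \<longlonglongrightarrow> complex_of_real (indicator C x)"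
      proof (rule AE_I2)
        fix x
        show "(\<lambda>n. g C n x) \<longlonglongrightarrow> complex_of_real (indicator C x)"
        proof (cases "x \<in> C")
          case True then show ?thesis by (simp add: g_def)
        next
          case False
          then have d: "infdist x C > 0" using C by (simp add: infdist_pos_not_in_closed)
          obtain N :: nat where N: "real N * infdist x C > 1"
            using d ex_less_of_nat_mult by blast
          have "g C n x = 0" if "n \<ge> N" for n
          proof -
            have "real N * infdist x C \<le> real n * infdist x C"
              using that d by (intro mult_right_mono) auto
            with N show ?thesis by (simp add: g_def)
          qed
          then have "\<forall>\<^sub>F n in sequentially. g C n x = 0"
            by (auto simp: eventually_sequentially)
          with False show ?thesis by (simp add: tendsto_eventually)
        qed
      qed
    qed auto
    also have "(\<integral>x. complex_of_real (indicator C x) \<partial>\<rho>) = complex_of_real (measure \<rho> C)"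
      using Cs by simp
    finally show ?thesis .
  qed
  have m: "measure \<mu> C = measure \<nu> C" if "C \<in> \<E>" for C
  \<comment> \<open>By convention \<open>infdist x {} = 0\<close>, so \<open>g {} n\<close> is
    constantly 1 and does not approximate the indicator of the empty set.\<close>
  proof (cases "C = {}")
    case False
    have c: "closed C" "C \<subseteq> K" using that by (auto simp: \<E>_def)
    have "continuous_on K (g C n)" for n
      unfolding g_def by (intro continuous_intros)
    then have "(\<lambda>n. integral\<^sup>L \<mu> (g C n)) = (\<lambda>n. integral\<^sup>L \<nu> (g C n))"
      using eq by blast
    with lim[OF M(1) c False] lim[OF M(2) c False]
    show ?thesis by (metis LIMSEQ_unique of_real_eq_iff)
  qed simp
  interpret \<mu>: prob_space \<mu> using s[OF M(1)] by simp
  interpret \<nu>: prob_space \<nu> using s[OF M(2)] by simp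
  show ?thesis
  proof (rule measure_eqI_generator_eq[where E=\<E> and \<Omega>=K and A="\<lambda>_. K"])
    show "Int_stable \<E>" by (auto simp: Int_stable_def \<E>_def)
    show "emeasure \<mu> X = emeasure \<nu> X" if "X \<in> \<E>" for X
      using m[OF that] by (simp add: \<mu>.emeasure_eq_measure \<nu>.emeasure_eq_measure)
    show "sets \<mu> = sigma_sets K \<E>" "sets \<nu> = sigma_sets K \<E>"
      using s M gen by auto
  qed (use clK in \<open>auto simp: \<E>_def\<close>)
qed

section \<open>The weak-star topology as an initial topology\<close>

lemma topspace_weak_star [simp]: "topspace (weak_star Y) = borel_prob_measures Y"
  by (auto simp: weak_star_def topspace_pullback_topology)

lemma continuous_map_weak_star_integral:
  assumes "f \<in> cont_functions Y"
  shows "continuous_map (weak_star Y) euclidean (\<lambda>\<mu>. integral\<^sup>L \<mu> f)"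
proof -
  have "continuous_map (weak_star Y) euclidean
      ((\<lambda>u. u f) \<circ> (\<lambda>\<mu>. \<lambda>f\<in>cont_functions Y. integral\<^sup>L \<mu> f))"
    unfolding weak_star_def
    by (intro continuous_map_pullback continuous_map_product_projection assms)
  then show ?thesis using assms by (simp add: o_def)
qed

text \<open>The topology is initial for the integrals against C(Y), so continuity into it can be
  tested one function \<open>f\<close> at a time.\<close>

lemma continuous_map_into_weak_star:
  assumes "\<And>x. x \<in> topspace X \<Longrightarrow> F x \<in> borel_prob_measures Y"
    and "\<And>f. f \<in> cont_functions Y \<Longrightarrow> continuous_map X euclidean (\<lambda>x. integral\<^sup>L (F x) f)"
  shows "continuous_map X (weak_star Y) F"
  unfolding weak_star_def
  by (intro continuous_map_pullback') (use assms in \<open>auto simp: o_def continuous_map_componentwise\<close>)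

lemma measurable_continuous_on_restrict_space:
  "continuous_on K f \<Longrightarrow> f \<in> K \<rightarrow> L \<Longrightarrow> f \<in> measurable (restrict_space borel K) (restrict_space borel L)"
  by (intro measurable_restrict_space2 borel_measurable_continuous_on_restrict)
     (auto simp: space_restrict_space)

section \<open>Invariance as an equation between image measures\<close>

lemma distr_self_eq_iff:
  assumes "prob_space \<mu>" "S \<in> measurable \<mu> \<mu>"
  shows "distr \<mu> \<mu> S = \<mu> \<longleftrightarrow> (\<forall>E\<in>sets \<mu>. measure \<mu> (S -` E \<inter> space \<mu>) = measure \<mu> E)"
proof
  show "distr \<mu> \<mu> S = \<mu> \<Longrightarrow> \<forall>E\<in>sets \<mu>. measure \<mu> (S -` E \<inter> space \<mu>) = measure \<mu> E"
    using measure_distr[OF assms(2)] by metis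
next
  interpret prob_space \<mu> by fact
  assume "\<forall>E\<in>sets \<mu>. measure \<mu> (S -` E \<inter> space \<mu>) = measure \<mu> E"
  then show "distr \<mu> \<mu> S = \<mu>"
    using assms(2) by (intro measure_eqI) (auto simp: emeasure_distr emeasure_eq_measure)
qed

lemma borel_prob_measuresD:
  assumes "\<mu> \<in> borel_prob_measures (top_of_set K)"
  shows "sets \<mu> = sets (restrict_space borel K)" "space \<mu> = K" "prob_space \<mu>"
  using assms sets_eq_imp_space_eq[of \<mu> "restrict_space borel K"]
  by (auto simp: borel_prob_measures_top_of_set space_restrict_space)

lemma borel_prob_measurable:
  assumes "\<mu> \<in> borel_prob_measures (top_of_set K)" "continuous_on K f" "f \<in> K \<rightarrow> L"
    "sets N = sets (restrict_space borel L)"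
  shows "f \<in> measurable \<mu> N"
  using measurable_continuous_on_restrict_space[OF assms(2,3)]
    measurable_cong_sets[OF borel_prob_measuresD(1)[OF assms(1)] assms(4)] by blast

text \<open>Written as a fixed-point equation of image measures, invariance passes along
  semiconjugacies and can be used under integrals through \<open>integral_distr\<close>.\<close>

lemma invariant_measures_iff:
  assumes "continuous_on K S" "S \<in> K \<rightarrow> K" "continuous_on K T" "T \<in> K \<rightarrow> K"
  shows "\<mu> \<in> invariant_measures (top_of_set K) S T \<longleftrightarrow>
    \<mu> \<in> borel_prob_measures (top_of_set K) \<and> distr \<mu> \<mu> S = \<mu> \<and> distr \<mu> \<mu> T = \<mu>"
proof (cases "\<mu> \<in> borel_prob_measures (top_of_set K)")
  case True
  note \<mu> = borel_prob_measuresD[OF True]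
  have "S \<in> measurable \<mu> \<mu>" "T \<in> measurable \<mu> \<mu>"
    using borel_prob_measurable[OF True] assms \<mu>(1) by auto
  then show ?thesis
    using True \<mu> by (auto simp: invariant_measures_def distr_self_eq_iff sets_borel_algebra)
qed (simp add: invariant_measures_def)

lemma distr_semiconjugate:
  assumes "\<pi> \<in> measurable M N" "S \<in> measurable M M" "S' \<in> measurable N N"
    and "\<And>x. x \<in> space M \<Longrightarrow> \<pi> (S x) = S' (\<pi> x)" and "distr M M S = M"
  shows "distr (distr M N \<pi>) (distr M N \<pi>) S' = distr M N \<pi>"
proof -
  have "distr (distr M N \<pi>) (distr M N \<pi>) S' = distr (distr M N \<pi>) N S'"
    by (rule distr_cong) auto
  also have "\<dots> = distr M N (S' \<circ> \<pi>)" using assms(1,3) by (rule distr_distr[rotated])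
  also have "\<dots> = distr M N (\<pi> \<circ> S)" using assms(4) by (intro distr_cong) auto
  also have "\<dots> = distr (distr M M S) N \<pi>" using assms(1,2) by (rule distr_distr[symmetric])
  finally show ?thesis using assms(5) by simp
qed

lemma borel_prob_distr:
  assumes "\<mu> \<in> borel_prob_measures (top_of_set K)" "f \<in> measurable \<mu> N"
    "sets N = sets (restrict_space borel L)"
  shows "distr \<mu> N f \<in> borel_prob_measures (top_of_set L)"
  using assms prob_space.prob_space_distr[OF borel_prob_measuresD(3)[OF assms(1)] assms(2)]
  by (auto simp: borel_prob_measures_top_of_set)

lemma borel_prob_integral_dist_le:
  fixes f g :: "'a::metric_space \<Rightarrow> complex"
  assumes "compact K" and \<mu>: "\<mu> \<in> borel_prob_measures (top_of_set K)"
    and fg: "continuous_on K f" "continuous_on K g" "\<And>x. x \<in> K \<Longrightarrow> dist (f x) (g x) \<le> e"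
  shows "dist (integral\<^sup>L \<mu> f) (integral\<^sup>L \<mu> g) \<le> e"
proof -
  interpret prob_space \<mu> using borel_prob_measuresD[OF \<mu>] by simp
  have i: "integrable \<mu> f" "integrable \<mu> g"
    using borel_prob_integrable[OF assms(1) \<mu>] fg by auto
  have "dist (integral\<^sup>L \<mu> f) (integral\<^sup>L \<mu> g) = norm (\<integral>x. f x - g x \<partial>\<mu>)"
    using i by (simp add: dist_norm)
  also have "\<dots> \<le> (\<integral>x. norm (f x - g x) \<partial>\<mu>)" by (rule integral_norm_bound)
  also have "\<dots> \<le> (\<integral>x. e \<partial>\<mu>)"
    using fg(3) borel_prob_measuresD(2)[OF \<mu>] i
    by (intro integral_mono) (auto simp: dist_norm)
  finally show ?thesis by (simp add: prob_space)
qed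

section \<open>Ergodicity and absolutely continuous invariant measures\<close>

lemma funpow_measurable: "T \<in> measurable M M \<Longrightarrow> T ^^ n \<in> measurable M M"
  by (induction n) (auto simp: funpow_Suc_right simp del: funpow.simps(2) intro: measurable_comp)

text \<open>The ergodicity hypothesis concerns strictly invariant sets, so an almost invariant set
  is first replaced by the set of points whose orbit visits it in arbitrarily late steps of both maps.\<close>

lemma ergodic_almost_invariant:
  assumes S: "S \<in> measurable M M" "distr M M S = M"
    and T: "T \<in> measurable M M" "distr M M T = M"
    and comm: "\<And>x. S (T x) = T (S x)"
    and erg: "\<And>E. E \<in> sets M \<Longrightarrow> S -` E \<inter> space M = E \<Longrightarrow> T -` E \<inter> space M = E \<Longrightarrow>
       measure M E \<in> {0, 1}"
    and B: "B \<in> sets M"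
    and BS: "AE x in M. S x \<in> B \<longleftrightarrow> x \<in> B" and BT: "AE x in M. T x \<in> B \<longleftrightarrow> x \<in> B"
  shows "measure M B \<in> {0, 1}"
proof -
  have push: "AE x in M. P (R x)" if "AE x in M. P x" "R \<in> measurable M M" "distr M M R = M"
    for P R
  proof (rule AE_distrD[OF that(2)])
    show "AE x in distr M M R. P x" unfolding that(3) by (rule that(1))
  qed
  have "AE x in M. (T ^^ j) x \<in> B \<longleftrightarrow> x \<in> B" for j
  proof (induction j)
    case (Suc j)
    from push[OF Suc T] BT show ?case
      by eventually_elim (simp add: funpow_Suc_right del: funpow.simps(2))
  qed simp
  then have orbit: "AE x in M. (T ^^ j) ((S ^^ i) x) \<in> B \<longleftrightarrow> x \<in> B" for i j
  proof (induction i)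
    case (Suc i)
    from push[OF Suc.IH[OF Suc.prems] S] BS show ?case
      by eventually_elim (simp add: funpow_Suc_right del: funpow.simps(2))
  qed simp
  \<comment> \<open>Both times must be allowed to be arbitrarily late: the condition then survives
    one more or one fewer application of either map, which gives strict invariance under
    both.\<close>
  define C where "C = {x \<in> space M. \<forall>n. \<exists>i\<ge>n. \<exists>j\<ge>n. (T ^^ j) ((S ^^ i) x) \<in> B}"
  have meas: "{x \<in> space M. (T ^^ j) ((S ^^ i) x) \<in> B} \<in> sets M" for i j
  proof -
    have "(\<lambda>x. (T ^^ j) ((S ^^ i) x)) \<in> measurable M M"
      using measurable_comp[OF funpow_measurable[OF S(1)] funpow_measurable[OF T(1)]]
      by (simp add: o_def)
    then show ?thesis using B by measurable
  qed
  have C: "C \<in> sets M"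
  proof -
    have "C = (\<Inter>n. \<Union>i\<in>{n..}. \<Union>j\<in>{n..}. {x \<in> space M. (T ^^ j) ((S ^^ i) x) \<in> B})"
      unfolding C_def by (simp add: set_eq_iff Bex_def)
    also have "\<dots> \<in> sets M"
      by (intro sets.countable_INT sets.countable_UN' countableI_type image_subsetI meas) auto
    finally show ?thesis .
  qed
  have "AE x in M. \<forall>i j. (T ^^ j) ((S ^^ i) x) \<in> B \<longleftrightarrow> x \<in> B"
    using orbit by (simp add: AE_all_countable)
  \<comment> \<open>At such a point the orbit lies in \<open>B\<close> always or never, according to
    its starting point, so recurrence to \<open>B\<close> is membership in \<open>B\<close>.\<close>
  then have "AE x in M. x \<in> C \<longleftrightarrow> x \<in> B"
    by (rule AE_mp) (rule AE_I2, auto simp: C_def)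
  then have eq: "measure M C = measure M B"
    using C B by (auto intro!: arg_cong[where f=enn2real] emeasure_eq_AE simp: measure_def)
  have sp: "S x \<in> space M" "T x \<in> space M" if "x \<in> space M" for x
    using that S(1) T(1) by (auto simp: measurable_def)
  have commi: "(S ^^ i) (T x) = T ((S ^^ i) x)" for i x
    by (induction i) (auto simp: comm)
  have "S -` C \<inter> space M = C"
  proof (intro set_eqI iffI)
    fix x assume "x \<in> S -` C \<inter> space M"
    then have x: "x \<in> space M" and *: "\<And>n. \<exists>i\<ge>n. \<exists>j\<ge>n. (T ^^ j) ((S ^^ Suc i) x) \<in> B"
      by (auto simp: C_def funpow_Suc_right simp del: funpow.simps(2))
    show "x \<in> C"
      unfolding C_def using x * by (blast intro: le_SucI)
  next
    fix x assume x: "x \<in> C"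
    have "\<exists>i\<ge>n. \<exists>j\<ge>n. (T ^^ j) ((S ^^ Suc i) x) \<in> B" for n
    proof -
      \<comment> \<open>Asking for times beyond \<open>Suc n\<close> leaves room to take one
        application of \<open>S\<close> away: \<open>i - 1\<close> is still at least
        \<open>n\<close>, and \<open>Suc (i - 1) = i\<close>.\<close>
      obtain i j where "i \<ge> Suc n" "j \<ge> Suc n" "(T ^^ j) ((S ^^ i) x) \<in> B"
        using x unfolding C_def by blast
      then show ?thesis
        by (intro exI[of _ "i - 1"] conjI exI[of _ j]) (auto simp del: funpow.simps(2))
    qed
    with x sp show "x \<in> S -` C \<inter> space M"
      by (auto simp: C_def funpow_Suc_right simp del: funpow.simps(2))
  qed
  moreover have "T -` C \<inter> space M = C"
  proof (intro set_eqI iffI)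
    fix x assume "x \<in> T -` C \<inter> space M"
    then have x: "x \<in> space M" and *: "\<And>n. \<exists>i\<ge>n. \<exists>j\<ge>n. (T ^^ Suc j) ((S ^^ i) x) \<in> B"
      by (auto simp: C_def funpow_Suc_right commi simp del: funpow.simps(2))
    show "x \<in> C"
      unfolding C_def using x * by (blast intro: le_SucI)
  next
    fix x assume x: "x \<in> C"
    have "\<exists>i\<ge>n. \<exists>j\<ge>n. (T ^^ Suc j) ((S ^^ i) x) \<in> B" for n
    proof -
      obtain i j where "i \<ge> Suc n" "j \<ge> Suc n" "(T ^^ j) ((S ^^ i) x) \<in> B"
        using x unfolding C_def by blast
      then show ?thesis
        by (intro exI[of _ i] conjI exI[of _ "j - 1"]) (auto simp del: funpow.simps(2))
    qed
    with x sp show "x \<in> T -` C \<inter> space M"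
      by (auto simp: C_def funpow_Suc_right commi simp del: funpow.simps(2))
  qed
  ultimately show ?thesis using erg[OF C] eq by simp
qed

text \<open>Superlevel sets of an invariant density are almost invariant: \<open>B - T -` B\<close> and
  \<open>T -` B - B\<close> have equal mass for both measures, but the density exceeds \<open>1\<close> only on
  the first.\<close>

lemma superlevel_almost_invariant:
  assumes "prob_space M" "prob_space N" and sets: "sets N = sets M"
    and f: "f \<in> borel_measurable M" "density M f = N"
    and T: "T \<in> measurable M M" "distr M M T = M" "distr N N T = N"
  defines "B \<equiv> {x \<in> space M. f x > 1}"
  shows "AE x in M. T x \<in> B \<longleftrightarrow> x \<in> B"
proof -
  interpret M: prob_space M by fact
  interpret N: prob_space N by fact
  have sp: "space N = space M" using sets by (rule sets_eq_imp_space_eq)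
  have B: "B \<in> sets M" unfolding B_def using f(1) by measurable
  have TB: "T -` B \<inter> space M \<in> sets M" using T(1) B by (rule measurable_sets)
  define D1 where "D1 = B - T -` B \<inter> space M"
  define D2 where "D2 = T -` B \<inter> space M - B"
  have D: "D1 \<in> sets M" "D2 \<in> sets M" using B TB by (auto simp: D1_def D2_def)
  have TN: "T \<in> measurable N N" using T(1) measurable_cong_sets[OF sets sets] by blast
  have inv: "measure M (T -` B \<inter> space M) = measure M B" "measure N (T -` B \<inter> space M) = measure N B"
    using measure_distr[OF T(1) B] measure_distr[OF TN, of B] B T(2,3) sp sets by auto
  have eqM: "measure M D1 = measure M D2"
  proof -
    have "measure M D1 = measure M B - measure M (B \<inter> (T -` B \<inter> space M))"
      unfolding D1_def using B TB by (rule M.finite_measure_Diff')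
    moreover have "measure M D2 = measure M (T -` B \<inter> space M) - measure M ((T -` B \<inter> space M) \<inter> B)"
      unfolding D2_def using TB B by (rule M.finite_measure_Diff')
    ultimately show ?thesis using inv by (simp add: Int_commute)
  qed
  have eqN: "measure N D1 = measure N D2"
  proof -
    have "measure N D1 = measure N B - measure N (B \<inter> (T -` B \<inter> space M))"
      unfolding D1_def using B TB sets by (intro N.finite_measure_Diff') auto
    moreover have "measure N D2 = measure N (T -` B \<inter> space M) - measure N ((T -` B \<inter> space M) \<inter> B)"
      unfolding D2_def using TB B sets by (intro N.finite_measure_Diff') auto
    ultimately show ?thesis using inv by (simp add: Int_commute)
  qed
  have Neq: "emeasure N E = (\<integral>\<^sup>+x. f x * indicator E x \<partial>M)" if "E \<in> sets M" for E
    using f emeasure_density[OF f(1) that] by simp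
  have "emeasure N D1 = emeasure N D2"
    using eqN by (simp add: N.emeasure_eq_measure)
  \<comment> \<open>On \<open>D2\<close> the density is at most 1, so N(D1) = N(D2) is at most M(D2)
    = M(D1).\<close>
  also have "\<dots> = (\<integral>\<^sup>+x. f x * indicator D2 x \<partial>M)" by (rule Neq[OF D(2)])
  also have "\<dots> \<le> (\<integral>\<^sup>+x. indicator D2 x \<partial>M)"
    by (intro nn_integral_mono) (auto simp: D2_def B_def indicator_def not_less)
  also have "\<dots> = emeasure M D1"
    using D eqM by (simp add: M.emeasure_eq_measure)
  finally have le: "(\<integral>\<^sup>+x. f x * indicator D1 x \<partial>M) \<le> (\<integral>\<^sup>+x. indicator D1 x \<partial>M)"
    using D Neq by simp
  \<comment> \<open>On \<open>D1\<close> the density exceeds 1, so the integrands are ordered the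
    other way pointwise. With \<open>le\<close> this leaves no set of positive measure where they
    differ, and \<open>D1\<close> is null.\<close>
  have "AE x in M. f x * indicator D1 x \<le> indicator D1 x"
  proof (rule ccontr)
    assume "\<not> ?thesis"
    then have "(\<integral>\<^sup>+x. indicator D1 x \<partial>M) < (\<integral>\<^sup>+x. f x * indicator D1 x \<partial>M)"
    proof (intro nn_integral_less)
      show "AE x in M. indicator D1 x \<le> f x * indicator D1 x"
        by (auto simp: D1_def B_def indicator_def intro!: AE_I2)
    qed (use D f(1) in \<open>auto simp: M.emeasure_eq_measure\<close>)
    with le show False by simp
  qed
  then have "AE x in M. x \<notin> D1"
  proof eventually_elim
    case (elim x)
    have "f x > 1" if "x \<in> D1" using that by (auto simp: D1_def B_def)
    then show ?case using elim by (auto simp: not_le)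
  qed
  then have "emeasure M D1 = 0" using AE_iff_null_sets[OF D(1)] by blast
  then have "emeasure M D2 = 0" using eqM by (simp add: M.emeasure_eq_measure)
  then have "AE x in M. x \<notin> D2"
    using D by (intro AE_not_in) auto
  with \<open>AE x in M. x \<notin> D1\<close> have "AE x in M. x \<notin> D1 \<and> x \<notin> D2" by (rule AE_conjI)
  then show ?thesis
    by (rule AE_mp) (auto simp: D1_def D2_def B_def)
qed

text \<open>One superlevel set of the Radon-Nikodym density \<open>f\<close> suffices. By ergodicity
  the set where \<open>f\<close> exceeds 1 is null or full. If it were full, the integral of
  \<open>f\<close> would exceed 1; if it is null, then \<open>f\<close> is at most 1 and has
  integral 1, so it equals 1 almost everywhere.\<close>

lemma ergodic_absolutely_continuous_eq:
  assumes "prob_space M" "prob_space N" and sets: "sets N = sets M"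
    and ac: "absolutely_continuous M N"
    and S: "S \<in> measurable M M" "distr M M S = M" "distr N N S = N"
    and T: "T \<in> measurable M M" "distr M M T = M" "distr N N T = N"
    and comm: "\<And>x. S (T x) = T (S x)"
    and erg: "\<And>E. E \<in> sets M \<Longrightarrow> S -` E \<inter> space M = E \<Longrightarrow> T -` E \<inter> space M = E \<Longrightarrow>
       measure M E \<in> {0, 1}"
  shows "N = M"
proof -
  interpret M: prob_space M by fact
  interpret N: prob_space N by fact
  obtain f where f: "f \<in> borel_measurable M" "density M f = N"
    using M.Radon_Nikodym[OF ac sets] by blast
  define B where "B = {x \<in> space M. f x > 1}"
  have B: "B \<in> sets M" unfolding B_def using f(1) by measurable
  have "measure M B \<in> {0, 1}"
    by (rule ergodic_almost_invariant[OF S(1,2) T(1,2) comm erg B])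
       (use superlevel_almost_invariant[OF assms(1,2,3) f] S T in \<open>auto simp: B_def\<close>)
  have tot: "(\<integral>\<^sup>+x. f x \<partial>M) = 1"
    using emeasure_density[OF f(1), of "space M"] f(2) N.emeasure_space_1
      sets_eq_imp_space_eq[OF sets]
    by (simp add: nn_integral_set_ennreal cong: nn_integral_cong)
  have "AE x in M. f x \<le> 1"
  proof (cases "measure M B = 0")
    case True
    then have "emeasure M B = 0" by (simp add: M.emeasure_eq_measure)
    then have "AE x in M. x \<notin> B" using B by (intro AE_not_in) auto
    then show ?thesis by (rule AE_mp) (auto simp: B_def not_less intro!: AE_I2)
  next
    case False
    with \<open>measure M B \<in> {0, 1}\<close> have "AE x in M. x \<in> B"
      using M.prob_eq_1[OF B] by simp
    then have gt: "AE x in M. f x > 1" by eventually_elim (simp add: B_def)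
    have "\<not> (AE x in M. f x \<le> 1)"
    proof
      assume "AE x in M. f x \<le> 1"
      with gt have "AE x in M. False" by eventually_elim simp
      then show False by simp
    qed
    then have "(\<integral>\<^sup>+x. 1 \<partial>M) < (\<integral>\<^sup>+x. f x \<partial>M)"
      using f gt by (intro nn_integral_less) (auto simp: M.emeasure_space_1 elim: eventually_mono)
    then show ?thesis using tot by (simp add: M.emeasure_space_1)
  qed
  moreover have "AE x in M. 1 \<le> f x"
  proof (rule ccontr)
    assume "\<not> ?thesis"
    then have "(\<integral>\<^sup>+x. f x \<partial>M) < (\<integral>\<^sup>+x. 1 \<partial>M)"
      using f tot calculation by (intro nn_integral_less) auto
    then show False using tot by (simp add: M.emeasure_space_1)
  qed
  ultimately have "AE x in M. f x = 1" by eventually_elim simp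
  then have "density M f = density M (\<lambda>_. 1)"
    using f by (intro density_cong) auto
  then show ?thesis using f(2) by (simp add: density_1)
qed

section \<open>The solenoid\<close>

locale solenoid_dual =
  fixes p q :: nat
  assumes pq: "p > 1" "q > 1"
begin

text \<open>Denominators are powers of \<open>of_nat (p * q)\<close>; the simplifier is kept from
  splitting this base into two factors.\<close>

declare of_nat_mult [simp del]

abbreviation "A \<equiv> Z_inv (p * q)"
abbreviation (input) "m \<equiv> p * q"
definition "Sol = topspace (solenoid p q)"

lemma pq_nonzero [simp]: "of_nat (p * q) \<noteq> (0::rat)" "p \<noteq> 0" "q \<noteq> 0" using pq by auto

section \<open>Arithmetic of the group Z[1/(pq)]\<close>

lemma Z_inv_iff: "g \<in> A \<longleftrightarrow> (\<exists>n. g * of_nat m ^ n \<in> \<int>)"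
proof
  assume "\<exists>n. g * of_nat m ^ n \<in> \<int>"
  then obtain n a where "g * of_nat m ^ n = of_int a" by (auto elim: Ints_cases)
  then have "g = of_int a / of_nat m ^ n" by (simp add: field_simps)
  then show "g \<in> A" by (auto simp: Z_inv_def)
next
  assume "g \<in> A"
  then obtain a n where "g = of_int a / of_nat m ^ n" by (auto simp: Z_inv_def)
  then have "g * of_nat m ^ n = of_int a" by simp
  then show "\<exists>n. g * of_nat m ^ n \<in> \<int>" by (metis Ints_of_int)
qed

lemma Ints_scale_mono:
  assumes "g * of_nat m ^ n \<in> (\<int> :: rat set)" "n \<le> k"
  shows "g * of_nat m ^ k \<in> \<int>"
proof -
  have "g * of_nat m ^ k = g * of_nat m ^ n * of_nat (m ^ (k - n))"
    using assms(2) by (simp add: mult.assoc del: of_nat_mult flip: power_add)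
  then show ?thesis using assms(1) by (metis Ints_mult Ints_of_nat)
qed

text \<open>Clearing denominators is monotone in the exponent, so the maximum of the individual
  exponents works. This is what reduces finitely many coordinates of a character to one.\<close>

lemma Z_inv_common:
  assumes "finite J" "J \<subseteq> A"
  shows "\<exists>n. \<forall>g\<in>J. g * of_nat m ^ n \<in> \<int>"
  using assms
proof (induction J rule: finite_induct)
  case (insert g J)
  then obtain n k where "\<forall>g\<in>J. g * of_nat m ^ n \<in> \<int>" "g * of_nat m ^ k \<in> \<int>"
    by (auto simp: Z_inv_iff)
  then show ?case by (intro exI[of _ "max n k"]) (auto intro: Ints_scale_mono)
qed simp

lemma Z_inv_add: "g \<in> A \<Longrightarrow> h \<in> A \<Longrightarrow> g + h \<in> A"
proof -
  assume "g \<in> A" "h \<in> A"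
  then obtain n where "g * of_nat m ^ n \<in> \<int>" "h * of_nat m ^ n \<in> \<int>"
    using Z_inv_common[of "{g, h}"] by auto
  then have "(g + h) * of_nat m ^ n \<in> \<int>" by (simp add: distrib_right)
  then show ?thesis unfolding Z_inv_iff by blast
qed

lemma Z_inv_mult: "g \<in> A \<Longrightarrow> of_nat k * g \<in> A"
proof -
  assume "g \<in> A"
  then obtain n where "g * of_nat m ^ n \<in> \<int>" unfolding Z_inv_iff by blast
  then have "of_nat k * g * of_nat m ^ n \<in> \<int>" by (simp add: mult.assoc)
  then show ?thesis unfolding Z_inv_iff by blast
qed

lemma Z_inv_inverse_power: "1 / of_nat m ^ n \<in> A"
  using pq by (auto simp: Z_inv_iff intro!: exI[of _ n])

section \<open>The solenoid as a compact space of characters\<close>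

lemma Sol_iff: "\<phi> \<in> Sol \<longleftrightarrow> (\<forall>g\<in>A. norm (\<phi> g) = 1) \<and> (\<forall>g. g \<notin> A \<longrightarrow> \<phi> g = undefined) \<and>
   (\<forall>g\<in>A. \<forall>h\<in>A. \<phi> (g + h) = \<phi> g * \<phi> h)"
  by (auto simp: Sol_def solenoid_def discrete_dual_def circle_def PiE_iff extensional_def)

text \<open>Replaces the product over \<open>A\<close> by a subspace of the full function type,
  which is a metric space because \<open>rat\<close> is countable. On extensional functions the
  coordinates outside \<open>A\<close> are constantly \<open>undefined\<close>, so they contribute
  no further open sets and the identity is continuous both ways.\<close>

lemma solenoid_eq: "solenoid p q = top_of_set Sol"
proof -
  have "product_topology (\<lambda>_. circle) A = top_of_set (PiE A (\<lambda>_. sphere 0 1))"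
  proof (rule topology_eq[THEN iffD2], intro allI iffI)
    fix U :: "(rat \<Rightarrow> complex) set"
    have c1: "continuous_map (product_topology (\<lambda>_. circle) A) (top_of_set (PiE A (\<lambda>_. sphere 0 1))) id"
    proof -
      have "continuous_map (product_topology (\<lambda>_. circle) A) euclidean (\<lambda>f :: rat \<Rightarrow> complex. f i)" for i
      proof (cases "i \<in> A")
        case True
        then have "continuous_map (product_topology (\<lambda>_. circle) A) circle (\<lambda>f. f i)"
          by (rule continuous_map_product_projection)
        then show ?thesis by (simp add: circle_def continuous_map_in_subtopology)
      next
        case False
        show ?thesis
          by (rule continuous_map_eq[where f="\<lambda>_. undefined"])
             (use False in \<open>auto simp: PiE_iff extensional_def\<close>)
      qed
      then have "continuous_map (product_topology (\<lambda>_. circle) A) euclidean (id :: (rat \<Rightarrow> complex) \<Rightarrow> _)"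
        unfolding euclidean_product_topology[symmetric]
        by (simp add: continuous_map_componentwise_UNIV id_def)
      then show ?thesis by (auto simp: continuous_map_in_subtopology circle_def)
    qed
    have c2: "continuous_map (top_of_set (PiE A (\<lambda>_. sphere 0 1))) (product_topology (\<lambda>_. circle) A) id"
      unfolding continuous_map_componentwise
      by (auto simp: circle_def continuous_map_in_subtopology PiE_iff
          intro: continuous_on_subset[OF continuous_on_product_coordinates])
    have sp: "topspace (product_topology (\<lambda>_. circle) A) = PiE A (\<lambda>_. sphere 0 1)"
      by (simp add: circle_def)
    have pre: "openin X U" if "continuous_map X Y id" "openin Y U" "topspace X = topspace Y"
      for X Y :: "(rat \<Rightarrow> complex) topology"
    proof -
      have "{x \<in> topspace X. id x \<in> U} = U" using openin_subset[OF that(2)] that(3) by auto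
      then show ?thesis using openin_continuous_map_preimage[OF that(1,2)] by simp
    qed
    show "openin (top_of_set (PiE A (\<lambda>_. sphere 0 1))) U" if "openin (product_topology (\<lambda>_. circle) A) U"
      by (rule pre[OF c2 that]) (simp add: circle_def)
    show "openin (product_topology (\<lambda>_. circle) A) U" if "openin (top_of_set (PiE A (\<lambda>_. sphere 0 1))) U"
      by (rule pre[OF c1 that]) (simp add: circle_def)
  qed
  then show ?thesis
    by (simp add: Sol_def solenoid_def discrete_dual_def subtopology_subtopology circle_def)
qed

text \<open>The solenoid is cut out by closed conditions on coordinates. Giving the indices outside
  \<open>A\<close> the compact factor \<open>{undefined}\<close> makes Tychonoff's theorem
  applicable over the whole index type.\<close>

lemma compact_Sol: "compact Sol"
proof -
  have eval: "continuous_on UNIV (\<lambda>\<phi> :: rat \<Rightarrow> complex. \<phi> g)" for g by simp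
  have "closed {\<phi> :: rat \<Rightarrow> complex. (g \<in> A \<longrightarrow> norm (\<phi> g) = 1) \<and> (g \<notin> A \<longrightarrow> \<phi> g = undefined)}" for g
    by (cases "g \<in> A") (simp_all add: closed_Collect_eq continuous_on_norm eval)
  moreover have "closed {\<phi> :: rat \<Rightarrow> complex. \<phi> (g + h) = \<phi> g * \<phi> h}" for g h
    by (intro closed_Collect_eq continuous_intros eval)
  moreover have "Sol = (\<Inter>g. {\<phi>. (g \<in> A \<longrightarrow> norm (\<phi> g) = 1) \<and> (g \<notin> A \<longrightarrow> \<phi> g = undefined)}) \<inter>
      (\<Inter>g\<in>A. \<Inter>h\<in>A. {\<phi>. \<phi> (g + h) = \<phi> g * \<phi> h})"
    by (auto simp: Sol_iff)
  ultimately have cl: "closed Sol" by (simp add: closed_INT closed_Int)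
  have "compactin (product_topology (\<lambda>_. euclidean) UNIV)
     (PiE UNIV (\<lambda>g. if g \<in> A then sphere 0 1 else {undefined :: complex}))"
    unfolding compactin_PiE by auto
  then have "compact (PiE UNIV (\<lambda>g. if g \<in> A then sphere 0 1 else {undefined :: complex}))"
    by (simp add: euclidean_product_topology)
  moreover have "Sol \<subseteq> PiE UNIV (\<lambda>g. if g \<in> A then sphere 0 1 else {undefined})"
    by (auto simp: Sol_iff)
  ultimately show ?thesis using cl by (metis compact_Int_closed inf.absorb_iff2)
qed

lemma SolD:
  assumes "\<phi> \<in> Sol"
  shows "g \<in> A \<Longrightarrow> norm (\<phi> g) = 1" "g \<in> A \<Longrightarrow> \<phi> g \<noteq> 0"
    "g \<in> A \<Longrightarrow> h \<in> A \<Longrightarrow> \<phi> (g + h) = \<phi> g * \<phi> h"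
  using assms by (auto simp: Sol_iff)

lemma Sol_power:
  assumes "\<phi> \<in> Sol" "g \<in> A"
  shows "\<phi> (of_nat k * g) = \<phi> g ^ k"
proof (induction k)
  case 0
  \<comment> \<open>The value at 0 is a nonzero number equal to its own square, hence 1.\<close>
  have "\<phi> (0 + 0) = \<phi> 0 * \<phi> 0"
    using assms Z_inv_mult[of g 0] by (intro SolD) auto
  then show ?case using SolD(2)[OF assms(1), of 0] Z_inv_mult[OF assms(2), of 0] by simp
next
  case (Suc k)
  have "\<phi> (of_nat (Suc k) * g) = \<phi> (g + of_nat k * g)" by (simp add: algebra_simps)
  also have "\<dots> = \<phi> g * \<phi> (of_nat k * g)" using assms by (intro SolD Z_inv_mult)
  finally show ?case using Suc by simp
qed

lemma Sol_eqI:
  assumes "\<phi> \<in> Sol" "\<psi> \<in> Sol" "\<And>n. \<phi> (1 / of_nat m ^ n) = \<psi> (1 / of_nat m ^ n)"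
  shows "\<phi> = \<psi>"
proof
  fix g
  show "\<phi> g = \<psi> g"
  proof (cases "g \<in> A")
    case True
    then obtain n a where g: "g = of_int a / of_nat m ^ n" by (auto simp: Z_inv_def)
    let ?u = "1 / of_nat m ^ n :: rat"
    have u: "?u \<in> A" by (rule Z_inv_inverse_power)
    show ?thesis
    proof (cases "a \<ge> 0")
      case True
      then have "g = of_nat (nat a) * ?u" by (simp add: g)
      then show ?thesis using Sol_power[OF _ u] assms by metis
    next
      case False
      \<comment> \<open>For a negative numerator, \<open>-a\<close> copies of \<open>?u\<close>
        cancel \<open>g\<close>, so only natural multiples of \<open>?u\<close> occur. Zero is
        written \<open>of_nat 0 * ?u\<close> to let \<open>Sol_power\<close> evaluate the character
        there.\<close>
      then have e: "g + of_nat (nat (- a)) * ?u = of_nat 0 * ?u" by (simp add: g)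
      have "\<omega> g * \<omega> ?u ^ nat (- a) = 1" if "\<omega> \<in> Sol" for \<omega>
      proof -
        have "\<omega> g * \<omega> (of_nat (nat (- a)) * ?u) = \<omega> (of_nat 0 * ?u)"
          unfolding e[symmetric] using SolD(3)[OF that True Z_inv_mult[OF u]] by simp
        then show ?thesis unfolding Sol_power[OF that u] by simp
      qed
      from this[OF assms(1)] this[OF assms(2)] show ?thesis
        using assms(3)[of n] SolD(2)[OF assms(2) u]
        by (metis mult_right_cancel mult_zero_right zero_neq_one)
    qed
  qed (use assms in \<open>auto simp: Sol_iff\<close>)
qed

section \<open>Coordinates and the action of the two maps on them\<close>

abbreviation "circ \<equiv> sphere (0 :: complex) 1"
abbreviation "proj n \<phi> \<equiv> (\<phi> :: rat \<Rightarrow> complex) (1 / of_nat m ^ n)"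
abbreviation "mult_by \<equiv> solenoid_times p q"

lemma proj_circ: "\<phi> \<in> Sol \<Longrightarrow> proj n \<phi> \<in> circ"
  using SolD(1)[OF _ Z_inv_inverse_power] by simp

lemma proj_power: "\<phi> \<in> Sol \<Longrightarrow> proj n \<phi> = proj (n + k) \<phi> ^ (m ^ k)"
proof -
  have "of_nat (m ^ k) * (1 / of_nat m ^ (n + k)) = (1 / of_nat m ^ n :: rat)"
    by (simp add: power_add divide_simps)
  then show "\<phi> \<in> Sol \<Longrightarrow> ?thesis"
    using Sol_power[OF _ Z_inv_inverse_power, of \<phi> "m ^ k" "n + k"] by simp
qed

lemma mult_by_Sol: "\<phi> \<in> Sol \<Longrightarrow> mult_by k \<phi> \<in> Sol"
  by (auto simp: Sol_iff solenoid_times_def Z_inv_mult Z_inv_add distrib_left)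

lemma mult_by_proj: "\<phi> \<in> Sol \<Longrightarrow> proj n (mult_by k \<phi>) = proj n \<phi> ^ k"
  using Sol_power[OF _ Z_inv_inverse_power, of \<phi> k n] Z_inv_inverse_power[of n]
  by (simp add: solenoid_times_def)

lemma continuous_proj: "continuous_on X (\<lambda>\<phi>. proj n \<phi>)"
  by (rule continuous_on_subset[of UNIV]) auto

lemma continuous_mult_by: "continuous_on X (mult_by k)"
proof -
  have "continuous_on X (\<lambda>\<phi> :: rat \<Rightarrow> complex. \<phi> (of_nat k * g))" for g
    by (rule continuous_on_subset[of UNIV]) auto
  then have "continuous_on X (\<lambda>\<phi>. mult_by k \<phi> g)" for g
    by (cases "g \<in> A") (auto simp: solenoid_times_def)
  then show ?thesis
    by (rule continuous_on_coordinatewise_then_product)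
qed

section \<open>Density of the functions of one coordinate\<close>

lemma continuous_on_circle_power:
  "continuous_on circ u \<Longrightarrow> continuous_on circ (\<lambda>z. u (z ^ k))"
  by (rule continuous_on_compose2[of circ u])
     (auto simp: norm_power continuous_on_power continuous_on_id)

text \<open>Sums and products of functions of two coordinates are functions of one later coordinate,
  so the class \<open>P\<close> is an algebra. It separates points through the real and imaginary
  parts of the coordinates, by \<open>Sol_eqI\<close>.\<close>

lemma Stone_Weierstrass_real:
  fixes f :: "(rat \<Rightarrow> complex) \<Rightarrow> real"
  assumes "continuous_on Sol f" "e > 0"
  shows "\<exists>n h. continuous_on circ h \<and> (\<forall>\<phi>\<in>Sol. \<bar>f \<phi> - h (proj n \<phi>)\<bar> < e)"
proof -
  define P where "P g \<longleftrightarrow> (\<exists>n h. continuous_on circ h \<and> (\<forall>\<phi>\<in>Sol. g \<phi> = h (proj n \<phi>)))"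
    for g :: "(rat \<Rightarrow> complex) \<Rightarrow> real"
  have comb: "P (\<lambda>\<phi>. F (g \<phi>) (g' \<phi>))" if Pg: "P g" "P g'"
    and F: "\<And>u v. continuous_on circ u \<Longrightarrow> continuous_on circ v \<Longrightarrow> continuous_on circ (\<lambda>x. F (u x) (v x))"
    for g g' F
  proof -
    obtain n h n' h' where h: "continuous_on circ h" "\<And>\<phi>. \<phi> \<in> Sol \<Longrightarrow> g \<phi> = h (proj n \<phi>)"
      "continuous_on circ h'" "\<And>\<phi>. \<phi> \<in> Sol \<Longrightarrow> g' \<phi> = h' (proj n' \<phi>)"
      using Pg unfolding P_def by blast
    show ?thesis
      unfolding P_def
    proof (intro exI conjI ballI)
      \<comment> \<open>The exponents are crossed: coordinate \<open>n\<close> is the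
        \<open>m ^ n'\<close>-th power of coordinate \<open>n + n'\<close>, and coordinate
        \<open>n'\<close> is its \<open>m ^ n\<close>-th power.\<close>
      show "continuous_on circ (\<lambda>z. F (h (z ^ (m ^ n'))) (h' (z ^ (m ^ n))))"
        by (intro F continuous_on_circle_power h)
      show "F (g \<phi>) (g' \<phi>) = F (h (proj (n + n') \<phi> ^ (m ^ n'))) (h' (proj (n + n') \<phi> ^ (m ^ n)))"
        if "\<phi> \<in> Sol" for \<phi>
        using h that proj_power[OF that, of n n'] proj_power[OF that, of n' n] by (simp add: add.commute)
    qed
  qed
  have "\<exists>g. P g \<and> (\<forall>\<phi>\<in>Sol. \<bar>f \<phi> - g \<phi>\<bar> < e)"
  proof (rule Stone_Weierstrass_HOL[OF compact_Sol _ _ _ _ _ assms])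
    show "P (\<lambda>_. c)" for c unfolding P_def by (intro exI[of _ 0] exI[of _ "\<lambda>_. c"]) auto
    show "continuous_on Sol g" if Pg: "P g" for g
    proof -
      obtain n h where h: "continuous_on circ h" "\<And>\<phi>. \<phi> \<in> Sol \<Longrightarrow> g \<phi> = h (proj n \<phi>)"
        using Pg unfolding P_def by blast
      have "continuous_on Sol (\<lambda>\<phi>. h (proj n \<phi>))"
        by (rule continuous_on_compose2[OF h(1) continuous_proj]) (use proj_circ in auto)
      then show ?thesis using h(2) by (simp cong: continuous_on_cong)
    qed
    show "P (\<lambda>x. u x + v x)" if "P u \<and> P v" for u v
      using that by (intro comb[of u v "(+)"] continuous_on_add) simp_all
    show "P (\<lambda>x. u x * v x)" if "P u \<and> P v" for u v
      using that by (intro comb[of u v "(*)"] continuous_on_mult) simp_all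
    show "\<exists>g. P g \<and> g \<phi> \<noteq> g \<psi>" if phipsi: "\<phi> \<in> Sol \<and> \<psi> \<in> Sol \<and> \<phi> \<noteq> \<psi>" for \<phi> \<psi>
    proof -
      obtain n where n: "proj n \<phi> \<noteq> proj n \<psi>" using Sol_eqI phipsi by blast
      have "continuous_on circ Re" "continuous_on circ Im"
        by (intro continuous_on_Re continuous_on_Im continuous_on_id)+
      then have "P (\<lambda>\<phi>. Re (proj n \<phi>))" "P (\<lambda>\<phi>. Im (proj n \<phi>))"
        unfolding P_def by blast+
      moreover have "Re (proj n \<phi>) \<noteq> Re (proj n \<psi>) \<or> Im (proj n \<phi>) \<noteq> Im (proj n \<psi>)"
        using n complex_eqI by blast
      ultimately show ?thesis by auto
    qed
  qed
  then obtain g n h where "\<And>\<phi>. \<phi> \<in> Sol \<Longrightarrow> \<bar>f \<phi> - g \<phi>\<bar> < e"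
    "continuous_on circ h" "\<And>\<phi>. \<phi> \<in> Sol \<Longrightarrow> g \<phi> = h (proj n \<phi>)"
    unfolding P_def by blast
  then show ?thesis by (intro exI[of _ n] exI[of _ h]) auto
qed

lemma Stone_Weierstrass_solenoid:
  fixes f :: "(rat \<Rightarrow> complex) \<Rightarrow> complex"
  assumes "continuous_on Sol f" "e > 0"
  shows "\<exists>n h. continuous_on circ h \<and> (\<forall>\<phi>\<in>Sol. dist (f \<phi>) (h (proj n \<phi>)) < e)"
proof -
  have c: "continuous_on Sol (\<lambda>\<phi>. Re (f \<phi>))" "continuous_on Sol (\<lambda>\<phi>. Im (f \<phi>))"
    using assms(1) by (auto intro!: continuous_intros)
  obtain n h where h: "continuous_on circ h" "\<And>\<phi>. \<phi> \<in> Sol \<Longrightarrow> \<bar>Re (f \<phi>) - h (proj n \<phi>)\<bar> < e / 2"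
    using Stone_Weierstrass_real[OF c(1), of "e / 2"] assms(2) by auto
  obtain n' h' where h': "continuous_on circ h'" "\<And>\<phi>. \<phi> \<in> Sol \<Longrightarrow> \<bar>Im (f \<phi>) - h' (proj n' \<phi>)\<bar> < e / 2"
    using Stone_Weierstrass_real[OF c(2), of "e / 2"] assms(2) by auto
  show ?thesis
  proof (intro exI conjI ballI)
    show "continuous_on circ (\<lambda>z. Complex (h (z ^ (m ^ n'))) (h' (z ^ (m ^ n))))"
      unfolding Complex_eq by (intro continuous_intros continuous_on_circle_power h h')
    fix \<phi> assume \<phi>: "\<phi> \<in> Sol"
    have "dist (f \<phi>) (Complex (h (proj n \<phi>)) (h' (proj n' \<phi>))) < e"
      using cmod_le[of "f \<phi> - Complex (h (proj n \<phi>)) (h' (proj n' \<phi>))"] h(2)[OF \<phi>] h'(2)[OF \<phi>]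
      by (simp add: dist_norm)
    then show "dist (f \<phi>) (Complex (h (proj (n + n') \<phi> ^ (m ^ n'))) (h' (proj (n + n') \<phi> ^ (m ^ n)))) < e"
      using proj_power[OF \<phi>, of n n'] proj_power[OF \<phi>, of n' n] by (simp add: add.commute)
  qed
qed

end

section \<open>Invariant measures on the solenoid and their images\<close>

context solenoid_dual
begin

abbreviation "circM \<equiv> restrict_space borel circ"
text \<open>Evaluation at 1 is \<open>proj 0\<close>, so this is the law of the coordinate of index
  0.\<close>

abbreviation "pushforward \<mu> \<equiv> distr \<mu> circM (\<lambda>\<phi> :: rat \<Rightarrow> complex. \<phi> 1)"

lemma circle_power: "continuous_on circ (\<lambda>z. z ^ k)" "(\<lambda>z. z ^ k) \<in> circ \<rightarrow> circ"
  by (auto intro: continuous_intros simp: norm_power)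

lemma mult_by_continuous: "continuous_on Sol (mult_by k)" "mult_by k \<in> Sol \<rightarrow> Sol"
  using continuous_mult_by mult_by_Sol by auto

lemma M_circle_iff: "\<nu> \<in> M_circle p q \<longleftrightarrow> \<nu> \<in> borel_prob_measures (top_of_set circ) \<and>
    distr \<nu> \<nu> (\<lambda>z. z ^ p) = \<nu> \<and> distr \<nu> \<nu> (\<lambda>z. z ^ q) = \<nu>"
  unfolding M_circle_def circle_def by (intro invariant_measures_iff circle_power)

lemma M_solenoid_iff: "\<mu> \<in> M_solenoid p q \<longleftrightarrow> \<mu> \<in> borel_prob_measures (top_of_set Sol) \<and>
    distr \<mu> \<mu> (mult_by p) = \<mu> \<and> distr \<mu> \<mu> (mult_by q) = \<mu>"
  unfolding M_solenoid_def solenoid_eq by (intro invariant_measures_iff mult_by_continuous)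

lemma measurable_mult_by:
  "\<mu> \<in> borel_prob_measures (top_of_set Sol) \<Longrightarrow> mult_by k \<in> measurable \<mu> \<mu>"
  by (rule borel_prob_measurable[OF _ mult_by_continuous]) (auto dest: borel_prob_measuresD)

lemma measurable_circle_power:
  "\<nu> \<in> borel_prob_measures (top_of_set circ) \<Longrightarrow> (\<lambda>z. z ^ k) \<in> measurable \<nu> \<nu>"
  by (rule borel_prob_measurable[OF _ circle_power]) (auto dest: borel_prob_measuresD)

lemma measurable_proj:
  "\<mu> \<in> borel_prob_measures (top_of_set Sol) \<Longrightarrow> (\<lambda>\<phi>. proj n \<phi>) \<in> measurable \<mu> circM"
  by (rule borel_prob_measurable[OF _ continuous_proj]) (use proj_circ in auto)

lemma measurable_eval_1:
  "\<mu> \<in> borel_prob_measures (top_of_set Sol) \<Longrightarrow> (\<lambda>\<phi>. \<phi> 1) \<in> measurable \<mu> circM"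
  using measurable_proj[of \<mu> 0] by simp

lemma continuous_on_comp_proj:
  "continuous_on circ h \<Longrightarrow> continuous_on Sol (\<lambda>\<phi>. h (proj n \<phi>))"
  by (rule continuous_on_compose2[OF _ continuous_proj]) (use proj_circ in auto)

text \<open>Integration against a probability measure is a contraction for the uniform norm, so
  agreement on a dense class is enough. The measures are arbitrary so that the criterion can also
  serve to prove invariance, with an image measure on one side.\<close>

lemma borel_prob_solenoid_eqI:
  assumes M: "\<mu> \<in> borel_prob_measures (top_of_set Sol)" "\<nu> \<in> borel_prob_measures (top_of_set Sol)"
    and eq: "\<And>n h. continuous_on circ h \<Longrightarrow>
      (\<integral>\<phi>. h (proj n \<phi>) \<partial>\<mu>) = (\<integral>\<phi>. h (proj n \<phi>) \<partial>\<nu> :: complex)"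
  shows "\<mu> = \<nu>"
proof (rule borel_prob_eqI[OF compact_Sol M])
  fix f :: "(rat \<Rightarrow> complex) \<Rightarrow> complex" assume f: "continuous_on Sol f"
  have "dist (integral\<^sup>L \<mu> f) (integral\<^sup>L \<nu> f) \<le> 0 + e" if e: "e > 0" for e
  proof -
    obtain n h where h: "continuous_on circ h" "\<And>\<phi>. \<phi> \<in> Sol \<Longrightarrow> dist (f \<phi>) (h (proj n \<phi>)) < e / 2"
      using Stone_Weierstrass_solenoid[OF f half_gt_zero[OF e]] by blast
    have "dist (integral\<^sup>L \<rho> f) (\<integral>\<phi>. h (proj n \<phi>) \<partial>\<rho>) \<le> e / 2"
      if "\<rho> \<in> borel_prob_measures (top_of_set Sol)" for \<rho>
      using h(2) by (intro borel_prob_integral_dist_le[OF compact_Sol that f]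
          continuous_on_comp_proj[OF h(1)]) (auto intro: less_imp_le)
    from this[OF M(1)] this[OF M(2)] eq[OF h(1), of n] show ?thesis
      using dist_triangle2[of "integral\<^sup>L \<mu> f" "integral\<^sup>L \<nu> f"] by (smt (verit) field_sum_of_halves)
  qed
  then have "dist (integral\<^sup>L \<mu> f) (integral\<^sup>L \<nu> f) \<le> 0" by (rule field_le_epsilon)
  then show "integral\<^sup>L \<mu> f = integral\<^sup>L \<nu> f" by simp
qed

section \<open>The restriction map as an image of measures\<close>

lemma pushforward_M_circle:
  assumes "\<mu> \<in> M_solenoid p q"
  shows "pushforward \<mu> \<in> M_circle p q"
proof -
  have \<mu>: "\<mu> \<in> borel_prob_measures (top_of_set Sol)" using assms by (simp add: M_solenoid_iff)
  have "distr (pushforward \<mu>) (pushforward \<mu>) (\<lambda>z. z ^ k) = pushforward \<mu>"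
    if "distr \<mu> \<mu> (mult_by k) = \<mu>" for k
  proof (rule distr_semiconjugate[OF measurable_eval_1[OF \<mu>] measurable_mult_by[OF \<mu>, of k] _ _ that])
    show "(\<lambda>z. z ^ k) \<in> measurable circM circM"
      by (intro measurable_continuous_on_restrict_space circle_power)
    show "mult_by k \<phi> 1 = \<phi> 1 ^ k" if "\<phi> \<in> space \<mu>" for \<phi>
      using mult_by_proj[of \<phi> k 0] that borel_prob_measuresD(2)[OF \<mu>] by simp
  qed
  then show ?thesis
    using assms borel_prob_distr[OF \<mu> measurable_eval_1[OF \<mu>] refl]
    by (auto simp: M_circle_iff M_solenoid_iff)
qed

lemma integral_pushforward:
  assumes "\<mu> \<in> borel_prob_measures (top_of_set Sol)" "continuous_on circ f"
  shows "integral\<^sup>L (pushforward \<mu>) f = (\<integral>\<phi>. f (\<phi> 1) \<partial>\<mu> :: complex)"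
  by (rule integral_distr[OF measurable_eval_1[OF assms(1)]])
     (rule borel_measurable_continuous_on_restrict[OF assms(2)])

text \<open>The image measure meets the description by change of variables, and nothing else does
  because continuous functions determine a Borel probability measure on the circle.\<close>

lemma restriction_map_eq_pushforward:
  assumes "\<mu> \<in> M_solenoid p q"
  shows "restriction_map p q \<mu> = pushforward \<mu>"
  unfolding restriction_map_def
proof (rule the_equality)
  have \<mu>: "\<mu> \<in> borel_prob_measures (top_of_set Sol)" using assms by (simp add: M_solenoid_iff)
  then show *: "pushforward \<mu> \<in> M_circle p q \<and> (\<forall>f\<in>cont_functions circle.
      integral\<^sup>L (pushforward \<mu>) f = integral\<^sup>L \<mu> (cont_embed f))"
    using pushforward_M_circle[OF assms] integral_pushforward[OF \<mu>]
    by (auto simp: circle_def cont_functions_top_of_set cont_embed_def)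
  fix \<nu> assume "\<nu> \<in> M_circle p q \<and> (\<forall>f\<in>cont_functions circle. integral\<^sup>L \<nu> f = integral\<^sup>L \<mu> (cont_embed f))"
  with * show "\<nu> = pushforward \<mu>"
    by (intro borel_prob_eqI[of circ])
       (auto simp: M_circle_iff circle_def cont_functions_top_of_set)
qed

text \<open>Invariance under the two maps is used once each: together they raise coordinate
  \<open>Suc n\<close> to the power \<open>m\<close>, which turns it into coordinate
  \<open>n\<close>.\<close>

lemma integral_comp_proj:
  assumes "\<mu> \<in> M_solenoid p q" "continuous_on circ h"
  shows "(\<integral>\<phi>. h (proj n \<phi>) \<partial>\<mu>) = (\<integral>\<phi>. h (\<phi> 1) \<partial>\<mu> :: complex)"
proof (induction n)
  case (Suc n)
  have \<mu>: "\<mu> \<in> borel_prob_measures (top_of_set Sol)" using assms by (simp add: M_solenoid_iff)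
  have shift: "integral\<^sup>L \<mu> f = (\<integral>\<phi>. f (mult_by k \<phi>) \<partial>\<mu>)"
    if "distr \<mu> \<mu> (mult_by k) = \<mu>" "continuous_on Sol f" for f :: "(rat \<Rightarrow> complex) \<Rightarrow> complex" and k
  proof -
    have "f \<in> borel_measurable \<mu>" using borel_prob_integrable[OF compact_Sol \<mu> that(2)] by auto
    from integral_distr[OF measurable_mult_by[OF \<mu>] this] show ?thesis using that(1) by metis
  qed
  have c: "continuous_on Sol (\<lambda>\<phi>. h (proj (Suc n) \<phi>))"
    by (rule continuous_on_comp_proj[OF assms(2)])
  have "(\<integral>\<phi>. h (proj (Suc n) \<phi>) \<partial>\<mu>) = (\<integral>\<phi>. h (proj (Suc n) (mult_by p \<phi>)) \<partial>\<mu>)"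
    using assms(1) c by (intro shift) (auto simp: M_solenoid_iff)
  also have "\<dots> = (\<integral>\<phi>. h (proj (Suc n) (mult_by p (mult_by q \<phi>))) \<partial>\<mu>)"
    using assms(1) mult_by_continuous[of p]
    by (intro shift continuous_on_compose2[OF c]) (auto simp: M_solenoid_iff)
  also have "\<dots> = (\<integral>\<phi>. h (proj n \<phi>) \<partial>\<mu>)"
  proof (rule Bochner_Integration.integral_cong[OF refl])
    fix \<phi> assume "\<phi> \<in> space \<mu>"
    then have \<phi>: "\<phi> \<in> Sol" using borel_prob_measuresD(2)[OF \<mu>] by simp
    show "h (proj (Suc n) (mult_by p (mult_by q \<phi>))) = h (proj n \<phi>)"
      unfolding mult_by_proj[OF mult_by_Sol[OF \<phi>]] mult_by_proj[OF \<phi>]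
      using proj_power[OF \<phi>, of n 1] by (simp add: power_mult mult.commute[of p])
  qed
  finally show ?case using Suc by simp
qed simp

lemma pushforward_inj: "inj_on pushforward (M_solenoid p q)"
proof (rule inj_onI)
  fix \<mu> \<nu> assume M: "\<mu> \<in> M_solenoid p q" "\<nu> \<in> M_solenoid p q" and eq: "pushforward \<mu> = pushforward \<nu>"
  show "\<mu> = \<nu>"
  proof (rule borel_prob_solenoid_eqI)
    show b: "\<mu> \<in> borel_prob_measures (top_of_set Sol)" "\<nu> \<in> borel_prob_measures (top_of_set Sol)"
      using M by (auto simp: M_solenoid_iff)
    fix n and h :: "complex \<Rightarrow> complex" assume h: "continuous_on circ h"
    show "(\<integral>\<phi>. h (proj n \<phi>) \<partial>\<mu>) = (\<integral>\<phi>. h (proj n \<phi>) \<partial>\<nu>)"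
      using integral_pushforward[OF b(1) h] integral_pushforward[OF b(2) h] eq
        integral_comp_proj[OF M(1) h] integral_comp_proj[OF M(2) h] by simp
  qed
qed

end

section \<open>Extension of invariant measures from the circle\<close>

lemma (in polish_projective) distr_lim_restrict:
  assumes "J \<subseteq> I" "finite J"
  shows "distr lim (PiM J (\<lambda>_. borel)) (\<lambda>x. restrict x J) = P J"
proof (rule measure_eqI)
  fix X assume "X \<in> sets (distr lim (PiM J (\<lambda>_. borel)) (\<lambda>x. restrict x J))"
  then have X: "X \<in> sets (PiM J (\<lambda>_. borel))" by simp
  have "(\<lambda>x. restrict x J) \<in> measurable lim (PiM J (\<lambda>_. borel))"
    using measurable_restrict_subset[OF assms(1)] measurable_cong_sets[OF sets_lim refl] by blast
  then show "emeasure (distr lim (PiM J (\<lambda>_. borel)) (\<lambda>x. restrict x J)) X = emeasure (P J) X"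
    using emeasure_lim_emb[OF assms X] X by (simp add: emeasure_distr prod_emb_def space_PiM)
qed (use assms sets_P in auto)

context solenoid_dual
begin

text \<open>For \<open>g * m ^ N \<in> \<int>\<close>, this is the value at \<open>g\<close> of any point \<open>\<phi>\<close> of the solenoid with
  \<open>proj N \<phi> = z\<close>.\<close>

definition lift_coord :: "nat \<Rightarrow> complex \<Rightarrow> rat \<Rightarrow> complex" where
  "lift_coord N z g = (if g \<in> A then z powi \<lfloor>g * of_nat m ^ N\<rfloor> else undefined)"

text \<open>For such \<open>N\<close> the floor in \<open>lift_coord\<close> is exact at every index
  in \<open>J\<close>, so these coordinates are integer powers of coordinate \<open>N\<close>.
  Indices outside \<open>A\<close> carry the constant \<open>undefined\<close> and need no
  condition.\<close>

definition admissible :: "rat set \<Rightarrow> nat \<Rightarrow> bool" where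
  "admissible J N \<longleftrightarrow> (\<forall>g\<in>J \<inter> A. g * of_nat m ^ N \<in> \<int>)"

text \<open>An arbitrary choice; by \<open>marginal_eq\<close> the laws built from it do not depend
  on it.\<close>

definition level :: "rat set \<Rightarrow> nat" where "level J = (SOME N. admissible J N)"

lemma admissible_level: "finite J \<Longrightarrow> admissible J (level J)"
  unfolding level_def admissible_def by (rule someI_ex, rule Z_inv_common) auto

lemma admissible_mono: "admissible J N \<Longrightarrow> I \<subseteq> J \<Longrightarrow> N \<le> k \<Longrightarrow> admissible I k"
  by (auto simp: admissible_def intro: Ints_scale_mono)

text \<open>Passing from \<open>N\<close> to \<open>N + k\<close> multiplies the exponent by
  \<open>m ^ k\<close>. Floors do not scale in this way in general; admissibility makes them
  exact.\<close>

lemma lift_coord_shift: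
  assumes "admissible J N" "g \<in> J"
  shows "lift_coord (N + k) z g = lift_coord N (z ^ (m ^ k)) g"
proof (cases "g \<in> A")
  case True
  then obtain a where a: "g * of_nat m ^ N = of_int a"
    using assms by (auto simp: admissible_def elim: Ints_cases)
  have "g * of_nat m ^ (N + k) = of_int (a * int (m ^ k))"
    using a by (simp add: power_add mult.assoc[symmetric])
  then have "\<lfloor>g * of_nat m ^ (N + k)\<rfloor> = int (m ^ k) * a" by (simp only: floor_of_int mult.commute)
  moreover have "\<lfloor>g * of_nat m ^ N\<rfloor> = a" using a by simp
  ultimately show ?thesis
    unfolding lift_coord_def by (simp add: power_int_mult del: of_nat_power)
qed (simp add: lift_coord_def)

lemma measurable_lift:
  assumes "sets \<nu> = sets circM"
  shows "(\<lambda>z. \<lambda>g\<in>J. lift_coord N z g) \<in> measurable \<nu> (PiM J (\<lambda>_. borel))"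
proof (rule measurable_restrict)
  fix g
  have "continuous_on circ (\<lambda>z. lift_coord N z g)"
    unfolding lift_coord_def
    by (cases "g \<in> A") (auto intro!: continuous_on_power_int continuous_on_id continuous_on_const)
  then show "(\<lambda>z. lift_coord N z g) \<in> measurable \<nu> borel"
    using borel_measurable_continuous_on_restrict measurable_cong_sets[OF assms refl] by blast
qed

end

section \<open>The projective limit of the finite-dimensional laws\<close>

locale circle_invariant = solenoid_dual +
  fixes \<nu> :: "complex measure"
  assumes \<nu>: "\<nu> \<in> M_circle p q"
begin

lemma borel_prob: "\<nu> \<in> borel_prob_measures (top_of_set circ)"
  and invariant: "distr \<nu> \<nu> (\<lambda>z. z ^ p) = \<nu>" "distr \<nu> \<nu> (\<lambda>z. z ^ q) = \<nu>"
  using \<nu> by (auto simp: M_circle_iff)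

lemmas sets_\<nu> = borel_prob_measuresD(1)[OF borel_prob]
lemmas space_\<nu> = borel_prob_measuresD(2)[OF borel_prob]
lemmas measurable_power = measurable_circle_power[OF borel_prob]

sublocale \<nu>: prob_space \<nu> by (rule borel_prob_measuresD(3)[OF borel_prob])

lemma distr_power_level: "distr \<nu> \<nu> (\<lambda>z. z ^ (m ^ k)) = \<nu>"
proof (induction k)
  case 0
  show ?case by (simp add: distr_id)
next
  case (Suc k)
  have "\<nu> = distr (distr (distr \<nu> \<nu> (\<lambda>z. z ^ p)) \<nu> (\<lambda>z. z ^ q)) \<nu> (\<lambda>z. z ^ (m ^ k))"
    using invariant Suc by simp
  also have "\<dots> = distr \<nu> \<nu> ((\<lambda>z. z ^ (m ^ k)) \<circ> ((\<lambda>z. z ^ q) \<circ> (\<lambda>z. z ^ p)))"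
    by (simp add: distr_distr measurable_power measurable_comp[OF measurable_power measurable_power])
  also have "((\<lambda>z. z ^ (m ^ k)) \<circ> ((\<lambda>z. z ^ q) \<circ> (\<lambda>z. z ^ p))) = (\<lambda>z :: complex. z ^ (m ^ Suc k))"
    by (simp add: fun_eq_iff mult.assoc flip: power_mult)
  finally show ?case by simp
qed

text \<open>The law on \<open>J\<close> that is forced on any measure whose coordinates all have law
  \<open>\<nu>\<close>: each entry is a function of the single coordinate of index
  \<open>level J\<close>.\<close>

definition marginal :: "rat set \<Rightarrow> (rat \<Rightarrow> complex) measure" where
  "marginal J = distr \<nu> (PiM J (\<lambda>_. borel)) (\<lambda>z. \<lambda>g\<in>J. lift_coord (level J) z g)"

text \<open>Both exponents are raised to their sum. Raising one by \<open>k\<close> precomposes the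
  lift with the power map of exponent \<open>m ^ k\<close>, which preserves
  \<open>\<nu>\<close>.\<close>

lemma marginal_eq:
  assumes "finite J" "admissible J N"
  shows "marginal J = distr \<nu> (PiM J (\<lambda>_. borel)) (\<lambda>z. \<lambda>g\<in>J. lift_coord N z g)"
proof -
  have shift: "distr \<nu> (PiM J (\<lambda>_. borel)) (\<lambda>z. \<lambda>g\<in>J. lift_coord (N + k) z g) =
      distr \<nu> (PiM J (\<lambda>_. borel)) (\<lambda>z. \<lambda>g\<in>J. lift_coord N z g)" if "admissible J N" for N k
  proof -
    have "distr \<nu> (PiM J (\<lambda>_. borel)) (\<lambda>z. \<lambda>g\<in>J. lift_coord (N + k) z g) =
      distr \<nu> (PiM J (\<lambda>_. borel)) ((\<lambda>z. \<lambda>g\<in>J. lift_coord N z g) \<circ> (\<lambda>z. z ^ (m ^ k)))"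
      using lift_coord_shift[OF that] by (intro distr_cong) (auto simp: restrict_def)
    also have "\<dots> = distr (distr \<nu> \<nu> (\<lambda>z. z ^ (m ^ k))) (PiM J (\<lambda>_. borel)) (\<lambda>z. \<lambda>g\<in>J. lift_coord N z g)"
      by (rule distr_distr[symmetric, OF measurable_lift[OF sets_\<nu>] measurable_power])
    finally show ?thesis by (simp add: distr_power_level)
  qed
  show ?thesis
    using shift[OF assms(2), of "level J"] shift[OF admissible_level[OF assms(1)], of N]
    by (simp add: marginal_def add.commute)
qed

text \<open>The exponent chosen for the larger set also serves the smaller one; at this common
  exponent consistency is just restriction of functions.\<close>

sublocale polish_projective UNIV marginal
proof (intro polish_projective.intro projective_family.intro)
  show "prob_space (marginal J)" if "finite J" for J
    unfolding marginal_def by (rule \<nu>.prob_space_distr[OF measurable_lift[OF sets_\<nu>]])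
  fix J H :: "rat set" assume JH: "J \<subseteq> H" and H: "finite H"
  have J: "finite J" using JH H by (rule finite_subset)
  have adm: "admissible H (level H)" by (rule admissible_level[OF H])
  have "marginal J = distr \<nu> (PiM J (\<lambda>_. borel)) (\<lambda>z. \<lambda>g\<in>J. lift_coord (level H) z g)"
    by (rule marginal_eq[OF J admissible_mono[OF adm JH order_refl]])
  also have "\<dots> = distr \<nu> (PiM J (\<lambda>_. borel)) ((\<lambda>f. restrict f J) \<circ> (\<lambda>z. \<lambda>g\<in>H. lift_coord (level H) z g))"
    using JH by (intro distr_cong) (auto simp: restrict_def fun_eq_iff)
  also have "\<dots> = distr (marginal H) (PiM J (\<lambda>_. borel)) (\<lambda>f. restrict f J)"
    unfolding marginal_def
    by (rule distr_distr[symmetric, OF measurable_restrict_subset[OF JH] measurable_lift[OF sets_\<nu>]])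
  finally show "marginal J = distr (marginal H) (PiM J (\<lambda>_. borel)) (\<lambda>f. restrict f J)" .
qed

text \<open>Finitely many coordinates under \<open>lim\<close> are distributed as lifts of a
  \<open>\<nu>\<close>-random point of the circle, so a condition on them can be checked lift by
  lift.\<close>

lemma AE_lim:
  assumes "finite J" "admissible J N"
    and "{y \<in> space (PiM J (\<lambda>_. borel)). Q y} \<in> sets (PiM J (\<lambda>_. borel))"
    and "\<And>z. z \<in> circ \<Longrightarrow> Q (\<lambda>g\<in>J. lift_coord N z g)"
  shows "AE \<phi> in lim. Q (restrict \<phi> J)"
proof -
  have meas: "(\<lambda>\<phi>. restrict \<phi> J) \<in> measurable lim (PiM J (\<lambda>_. borel))"
    using measurable_restrict_subset[of J UNIV] measurable_cong_sets[OF sets_lim refl] by blast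
  have "AE y in distr \<nu> (PiM J (\<lambda>_. borel)) (\<lambda>z. \<lambda>g\<in>J. lift_coord N z g). Q y"
    using assms(3,4) space_\<nu> by (subst AE_distr_iff[OF measurable_lift[OF sets_\<nu>]]) auto
  then have "AE y in distr lim (PiM J (\<lambda>_. borel)) (\<lambda>\<phi>. restrict \<phi> J). Q y"
    unfolding distr_lim_restrict[OF subset_UNIV assms(1)] marginal_eq[OF assms(1,2)] .
  from AE_distrD[OF meas this] show ?thesis .
qed

text \<open>Every defining condition of the solenoid involves at most three coordinates, and there
  are countably many conditions because \<open>rat\<close> is countable.\<close>

lemma AE_lim_Sol: "AE \<phi> in lim. \<phi> \<in> Sol"
proof -
  have 1: "AE \<phi> in lim. (if g \<in> A then norm (\<phi> g) = 1 else \<phi> g = undefined)" for g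
  proof -
    have "AE \<phi> in lim. (\<lambda>y. if g \<in> A then norm (y g) = 1 else y g = undefined) (restrict \<phi> {g})"
      by (rule AE_lim[OF _ admissible_level])
         (auto simp: lift_coord_def norm_power_int)
    then show ?thesis by (cases "g \<in> A") simp_all
  qed
  have 2: "AE \<phi> in lim. \<phi> (g + h) = \<phi> g * \<phi> h" if gh: "g \<in> A" "h \<in> A" for g h
  proof -
    let ?J = "{g, h, g + h}"
    have adm: "admissible ?J (level ?J)" by (rule admissible_level) simp
    have "AE \<phi> in lim. (\<lambda>y. y (g + h) = y g * y h) (restrict \<phi> ?J)"
    proof (rule AE_lim[OF _ adm])
      fix z assume "z \<in> circ"
      then have "z \<noteq> 0" by auto
      obtain a b where "g * of_nat m ^ level ?J = of_int a" "h * of_nat m ^ level ?J = of_int b"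
        using adm gh by (auto simp: admissible_def elim!: Ints_cases)
      \<comment> \<open>The floors add up because both products are integers, which is what
        admissibility of the exponent provides.\<close>
      then have "\<lfloor>(g + h) * of_nat m ^ level ?J\<rfloor> = \<lfloor>g * of_nat m ^ level ?J\<rfloor> + \<lfloor>h * of_nat m ^ level ?J\<rfloor>"
        by (simp only: distrib_right floor_of_int flip: of_int_add)
      then have "lift_coord (level ?J) z (g + h) = lift_coord (level ?J) z g * lift_coord (level ?J) z h"
        using gh Z_inv_add[OF gh] \<open>z \<noteq> 0\<close> unfolding lift_coord_def by (simp add: power_int_add)
      then show "(\<lambda>k\<in>?J. lift_coord (level ?J) z k) (g + h) =
          (\<lambda>k\<in>?J. lift_coord (level ?J) z k) g * (\<lambda>k\<in>?J. lift_coord (level ?J) z k) h" by simp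
    qed auto
    then show ?thesis by simp
  qed
  have "AE \<phi> in lim. \<forall>g. (if g \<in> A then norm (\<phi> g) = 1 else \<phi> g = undefined)"
    using 1 by (simp add: AE_all_countable)
  moreover have "AE \<phi> in lim. \<forall>g h. g \<in> A \<longrightarrow> h \<in> A \<longrightarrow> \<phi> (g + h) = \<phi> g * \<phi> h"
    using 2 by (simp add: AE_all_countable)
  ultimately show ?thesis
  proof eventually_elim
    case (elim \<phi>)
    then show ?case unfolding Sol_iff by meson
  qed
qed

section \<open>The invariant measure above a given one\<close>

definition "extension = restrict_space lim Sol"

text \<open>Over the countable index type the product sigma-algebra is the Borel one, so the compact
  set \<open>Sol\<close> is measurable for \<open>lim\<close>.\<close>

lemma sets_lim_borel: "sets lim = sets borel"
  using sets_PiM_equal_borel by simp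

lemma Sol_sets: "Sol \<in> sets lim"
  using compact_imp_closed[OF compact_Sol] unfolding sets_lim_borel by (rule borel_closed)

lemma extension_borel_prob: "extension \<in> borel_prob_measures (top_of_set Sol)"
proof -
  have "emeasure lim Sol = 1"
    using P.emeasure_eq_1_AE[OF Sol_sets AE_lim_Sol] .
  then have "prob_space extension"
    unfolding extension_def using Sol_sets by (intro prob_space_restrict_space) auto
  moreover have "sets extension = sets (restrict_space borel Sol)"
    unfolding extension_def by (rule restrict_space_sets_cong[OF refl sets_lim_borel])
  ultimately show ?thesis by (simp add: borel_prob_measures_top_of_set)
qed

text \<open>At the index of coordinate \<open>n\<close> the exponent \<open>n\<close> is admissible
  and the lift of \<open>z\<close> is \<open>z\<close> itself, so the marginal there is
  \<open>\<nu>\<close>. All \<open>n\<close> are covered because the invariance proof compares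
  measures coordinate by coordinate.\<close>

lemma distr_extension_proj: "distr extension circM (\<lambda>\<phi>. proj n \<phi>) = \<nu>"
proof (rule measure_eqI)
  fix E assume "E \<in> sets (distr extension circM (\<lambda>\<phi>. proj n \<phi>))"
  then have E: "E \<in> sets circM" by simp
  then have Eb: "E \<in> sets borel" "E \<subseteq> circ" by (auto simp: sets_restrict_space)
  let ?u = "1 / of_nat m ^ n :: rat"
  have adm: "admissible {?u} n" by (simp add: admissible_def)
  have ev: "(\<lambda>\<phi>. \<phi> ?u) \<in> measurable lim borel"
    using measurable_component_singleton[of ?u UNIV "\<lambda>_. borel"] measurable_cong_sets[OF sets_lim refl]
    by blast
  have "emeasure (distr extension circM (\<lambda>\<phi>. proj n \<phi>)) E =
      emeasure extension ((\<lambda>\<phi>. proj n \<phi>) -` E \<inter> Sol)"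
    using emeasure_distr[OF measurable_proj[OF extension_borel_prob] E]
      borel_prob_measuresD(2)[OF extension_borel_prob] by simp
  also have "\<dots> = emeasure lim ((\<lambda>\<phi>. proj n \<phi>) -` E \<inter> Sol)"
    unfolding extension_def using Sol_sets by (intro emeasure_restrict_space) auto
  also have "\<dots> = emeasure lim ((\<lambda>\<phi>. proj n \<phi>) -` E \<inter> space lim)"
  proof (rule emeasure_eq_AE)
    show "AE \<phi> in lim. \<phi> \<in> (\<lambda>\<phi>. proj n \<phi>) -` E \<inter> Sol \<longleftrightarrow> \<phi> \<in> (\<lambda>\<phi>. proj n \<phi>) -` E \<inter> space lim"
      using AE_lim_Sol by eventually_elim (auto simp: space_PiM)
    show *: "(\<lambda>\<phi>. proj n \<phi>) -` E \<inter> space lim \<in> sets lim"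
      using measurable_sets[OF ev Eb(1)] .
    have "(\<lambda>\<phi>. proj n \<phi>) -` E \<inter> Sol = ((\<lambda>\<phi>. proj n \<phi>) -` E \<inter> space lim) \<inter> Sol"
      by (auto simp: space_PiM)
    then show "(\<lambda>\<phi>. proj n \<phi>) -` E \<inter> Sol \<in> sets lim"
      using * Sol_sets by (metis sets.Int)
  qed
  also have "\<dots> = emeasure (distr lim borel (\<lambda>\<phi>. \<phi> ?u)) E"
    using ev Eb by (simp add: emeasure_distr)
  also have "distr lim borel (\<lambda>\<phi>. \<phi> ?u) =
      distr (distr lim (PiM {?u} (\<lambda>_. borel)) (\<lambda>\<phi>. restrict \<phi> {?u})) borel (\<lambda>y. y ?u)"
  proof -
    have "(\<lambda>\<phi>. restrict \<phi> {?u}) \<in> measurable lim (PiM {?u} (\<lambda>_. borel))"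
      using measurable_restrict_subset[of "{?u}" UNIV] measurable_cong_sets[OF sets_lim refl] by blast
    then show ?thesis
      by (subst distr_distr) (auto simp: o_def)
  qed
  also have "\<dots> = distr (distr \<nu> (PiM {?u} (\<lambda>_. borel)) (\<lambda>z. \<lambda>g\<in>{?u}. lift_coord n z g)) borel (\<lambda>y. y ?u)"
    using distr_lim_restrict[of "{?u}"] marginal_eq[OF _ adm] by simp
  also have "\<dots> = distr \<nu> borel (\<lambda>z. lift_coord n z ?u)"
    by (subst distr_distr[OF _ measurable_lift[OF sets_\<nu>]]) (auto simp: o_def)
  also have "(\<lambda>z. lift_coord n z ?u) = (\<lambda>z. z)"
    using Z_inv_inverse_power[of n] by (simp add: lift_coord_def fun_eq_iff)
  also have "emeasure (distr \<nu> borel (\<lambda>z. z)) E = emeasure \<nu> E"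
  proof -
    have "(\<lambda>z. z) \<in> measurable \<nu> borel"
      using borel_measurable_continuous_on_restrict[OF continuous_on_id] measurable_cong_sets[OF sets_\<nu> refl]
      by blast
    then show ?thesis
      using Eb space_\<nu> by (simp add: emeasure_distr Int_absorb2)
  qed
  finally show "emeasure (distr extension circM (\<lambda>\<phi>. proj n \<phi>)) E = emeasure \<nu> E" .
qed (simp add: sets_\<nu>)

text \<open>It suffices to test functions of one coordinate. On each of them the map acts as a power
  map of the circle, and each has the law \<open>\<nu>\<close>, which that power map
  preserves.\<close>

lemma extension_M_solenoid: "extension \<in> M_solenoid p q"
proof -
  note ext = extension_borel_prob
  have inv: "distr extension extension (mult_by k) = extension" if k: "distr \<nu> \<nu> (\<lambda>z. z ^ k) = \<nu>" for k
  proof (rule borel_prob_solenoid_eqI)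
    show "distr extension extension (mult_by k) \<in> borel_prob_measures (top_of_set Sol)"
      by (rule borel_prob_distr[OF ext measurable_mult_by[OF ext] borel_prob_measuresD(1)[OF ext]])
    fix n and h :: "complex \<Rightarrow> complex" assume h: "continuous_on circ h"
    have int: "integral\<^sup>L \<nu> f = (\<integral>\<phi>. f (proj n \<phi>) \<partial>extension)" if "continuous_on circ f"
      for f :: "complex \<Rightarrow> complex"
      using integral_distr[OF measurable_proj[OF ext] borel_measurable_continuous_on_restrict[OF that], of n]
      by (simp add: distr_extension_proj)
    have hm: "h \<in> borel_measurable \<nu>"
      using borel_measurable_continuous_on_restrict[OF h] measurable_cong_sets[OF sets_\<nu> refl] by blast
    have "(\<integral>\<phi>. h (proj n \<phi>) \<partial>distr extension extension (mult_by k)) =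
        (\<integral>\<phi>. h (proj n (mult_by k \<phi>)) \<partial>extension)"
      using borel_prob_integrable[OF compact_Sol ext continuous_on_comp_proj[OF h]]
      by (intro integral_distr measurable_mult_by[OF ext]) auto
    also have "\<dots> = (\<integral>\<phi>. h (proj n \<phi> ^ k) \<partial>extension)"
      using borel_prob_measuresD(2)[OF ext] mult_by_proj
      by (intro Bochner_Integration.integral_cong) auto
    also have "\<dots> = (\<integral>z. h (z ^ k) \<partial>\<nu>)"
      by (rule int[symmetric, OF continuous_on_circle_power[OF h]])
    also have "\<dots> = integral\<^sup>L \<nu> h"
      using integral_distr[OF measurable_power hm, of k] k by simp
    also have "\<dots> = (\<integral>\<phi>. h (proj n \<phi>) \<partial>extension)" by (rule int[OF h])
    finally show "(\<integral>\<phi>. h (proj n \<phi>) \<partial>distr extension extension (mult_by k)) =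
        (\<integral>\<phi>. h (proj n \<phi>) \<partial>extension)" .
  qed (rule ext)
  show ?thesis using inv invariant ext by (simp add: M_solenoid_iff)
qed

lemma pushforward_extension: "pushforward extension = \<nu>"
  using distr_extension_proj[of 0] by simp

end

context solenoid_dual
begin

lemma pushforward_image: "pushforward ` M_solenoid p q = M_circle p q"
proof
  show "pushforward ` M_solenoid p q \<subseteq> M_circle p q" using pushforward_M_circle by blast
  show "M_circle p q \<subseteq> pushforward ` M_solenoid p q"
  proof
    fix \<nu> assume "\<nu> \<in> M_circle p q"
    then interpret circle_invariant p q \<nu> by unfold_locales
    show "\<nu> \<in> pushforward ` M_solenoid p q"
      using pushforward_extension extension_M_solenoid by (metis imageI)
  qed
qed

end

section \<open>Ergodic measures and the homeomorphisms\<close>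

context solenoid_dual
begin

section \<open>Ergodicity on the solenoid and on the circle\<close>

lemma Sol_vimage_mult_by:
  assumes "E \<subseteq> circ" "(\<lambda>z. z ^ k) -` E \<inter> circ = E"
  shows "mult_by k -` {\<phi> \<in> Sol. \<phi> 1 \<in> E} \<inter> Sol = {\<phi> \<in> Sol. \<phi> 1 \<in> E}"
proof -
  have "mult_by k \<phi> 1 \<in> E \<longleftrightarrow> \<phi> 1 \<in> E" if "\<phi> \<in> Sol" for \<phi>
    using mult_by_proj[OF that, of k 0] proj_circ[OF that, of 0] assms(2) by auto
  then show ?thesis using mult_by_Sol by auto
qed

lemma ergodic_pushforward:
  assumes "\<mu> \<in> EM_solenoid p q"
  shows "pushforward \<mu> \<in> EM_circle p q"
proof -
  have M: "\<mu> \<in> M_solenoid p q"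
    and erg: "\<And>E. E \<in> sets (restrict_space borel Sol) \<Longrightarrow> mult_by p -` E \<inter> Sol = E \<Longrightarrow>
      mult_by q -` E \<inter> Sol = E \<Longrightarrow> measure \<mu> E \<in> {0, 1}"
    using assms by (auto simp: EM_solenoid_def ergodic_measures_def M_solenoid_def solenoid_eq sets_borel_algebra)
  have \<mu>: "\<mu> \<in> borel_prob_measures (top_of_set Sol)" using M by (simp add: M_solenoid_iff)
  have "measure (pushforward \<mu>) E \<in> {0, 1}"
    if E: "E \<in> sets circM" "(\<lambda>z. z ^ p) -` E \<inter> circ = E" "(\<lambda>z. z ^ q) -` E \<inter> circ = E" for E
  proof -
    have sub: "E \<subseteq> circ" using E by auto
    have eq: "(\<lambda>\<phi>. \<phi> 1) -` E \<inter> space \<mu> = {\<phi> \<in> Sol. \<phi> 1 \<in> E}"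
      using borel_prob_measuresD(2)[OF \<mu>] by auto
    have "measure (pushforward \<mu>) E = measure \<mu> {\<phi> \<in> Sol. \<phi> 1 \<in> E}"
      using measure_distr[OF measurable_eval_1[OF \<mu>] E(1)] eq by simp
    moreover have "{\<phi> \<in> Sol. \<phi> 1 \<in> E} \<in> sets (restrict_space borel Sol)"
      using measurable_sets[OF measurable_eval_1[OF \<mu>] E(1)] eq borel_prob_measuresD(1)[OF \<mu>] by simp
    ultimately show ?thesis
      using erg Sol_vimage_mult_by[OF sub] E by simp
  qed
  then show ?thesis
    using pushforward_M_circle[OF M]
    by (auto simp: EM_circle_def ergodic_measures_def M_circle_def circle_def sets_borel_algebra)
qed

lemma uniform_measure_M_solenoid:
  assumes M: "\<mu> \<in> M_solenoid p q" and E: "E \<in> sets \<mu>" "measure \<mu> E \<noteq> 0"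
    and inv: "mult_by p -` E \<inter> Sol = E" "mult_by q -` E \<inter> Sol = E"
  shows "uniform_measure \<mu> E \<in> M_solenoid p q"
proof -
  have \<mu>: "\<mu> \<in> borel_prob_measures (top_of_set Sol)" using M by (simp add: M_solenoid_iff)
  note D = borel_prob_measuresD[OF \<mu>]
  interpret prob_space \<mu> by (rule D(3))
  let ?U = "uniform_measure \<mu> E"
  have b: "?U \<in> borel_prob_measures (top_of_set Sol)"
    using E D by (auto simp: borel_prob_measures_top_of_set emeasure_eq_measure intro!: prob_space_uniform_measure)
  have "distr ?U ?U (mult_by k) = ?U"
    if k: "distr \<mu> \<mu> (mult_by k) = \<mu>" "mult_by k -` E \<inter> Sol = E" for k
  proof (rule measure_eqI)
    fix B assume "B \<in> sets (distr ?U ?U (mult_by k))"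
    then have B: "B \<in> sets \<mu>" by simp
    have pre: "mult_by k -` B \<inter> Sol \<in> sets \<mu>"
      using measurable_sets[OF measurable_mult_by[OF \<mu>] B] D by simp
    \<comment> \<open>Invariance of \<open>E\<close> moves the intersection inside the preimage,
      after which invariance of \<open>\<mu>\<close> applies to \<open>E \<inter> B\<close>.\<close>
    have "emeasure \<mu> (E \<inter> (mult_by k -` B \<inter> Sol)) = emeasure \<mu> (mult_by k -` (E \<inter> B) \<inter> Sol)"
      using k(2) by (intro arg_cong[where f="emeasure \<mu>"]) auto
    also have "\<dots> = emeasure (distr \<mu> \<mu> (mult_by k)) (E \<inter> B)"
      using E B D by (simp add: emeasure_distr[OF measurable_mult_by[OF \<mu>]])
    finally have "emeasure \<mu> (E \<inter> (mult_by k -` B \<inter> Sol)) = emeasure \<mu> (E \<inter> B)"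
      using k(1) by simp
    then show "emeasure (distr ?U ?U (mult_by k)) B = emeasure ?U B"
      using B E(1) pre borel_prob_measuresD(2)[OF b]
      by (simp add: emeasure_distr[OF measurable_mult_by[OF b]] emeasure_uniform_measure del: space_uniform_measure)
  qed simp
  then show ?thesis using M b inv by (simp add: M_solenoid_iff)
qed

lemma pushforward_ergodicD:
  assumes M: "\<mu> \<in> M_solenoid p q" and erg: "pushforward \<mu> \<in> EM_circle p q"
  shows "\<mu> \<in> EM_solenoid p q"
proof -
  have \<mu>: "\<mu> \<in> borel_prob_measures (top_of_set Sol)" using M by (simp add: M_solenoid_iff)
  note D = borel_prob_measuresD[OF \<mu>]
  interpret prob_space \<mu> by (rule D(3))
  have "measure \<mu> E \<in> {0, 1}" if E: "E \<in> sets \<mu>" "mult_by p -` E \<inter> Sol = E" "mult_by q -` E \<inter> Sol = E" for E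
  proof (cases "measure \<mu> E = 0")
    case False
    let ?U = "uniform_measure \<mu> E"
    have U: "?U \<in> M_solenoid p q" by (rule uniform_measure_M_solenoid[OF M E(1) False E(2,3)])
    have Ub: "?U \<in> borel_prob_measures (top_of_set Sol)" using U by (simp add: M_solenoid_iff)
    have c: "pushforward \<mu> \<in> borel_prob_measures (top_of_set circ)"
      "pushforward ?U \<in> borel_prob_measures (top_of_set circ)"
      using pushforward_M_circle[OF M] pushforward_M_circle[OF U] by (auto simp: M_circle_iff)
    have "pushforward ?U = pushforward \<mu>"
    proof (rule ergodic_absolutely_continuous_eq)
      show "prob_space (pushforward \<mu>)" "prob_space (pushforward ?U)"
        using c by (auto dest: borel_prob_measuresD)
      show "absolutely_continuous (pushforward \<mu>) (pushforward ?U)"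
        unfolding absolutely_continuous_def
      proof
        fix B assume B: "B \<in> null_sets (pushforward \<mu>)"
        then have Bs: "B \<in> sets circM" by auto
        let ?B = "(\<lambda>\<phi>. \<phi> 1) -` B \<inter> space \<mu>"
        have pre: "?B \<in> sets \<mu>" by (rule measurable_sets[OF measurable_eval_1[OF \<mu>] Bs])
        \<comment> \<open>The preimage of \<open>B\<close> is already null for \<open>\<mu>\<close>;
          conditioning only intersects with \<open>E\<close> and rescales, so it stays null.\<close>
        have "emeasure \<mu> ?B = 0"
          using B emeasure_distr[OF measurable_eval_1[OF \<mu>] Bs] by auto
        then have "emeasure \<mu> (E \<inter> ?B) = 0"
          using emeasure_mono[OF Int_lower2 pre, of E] by simp
        then have "emeasure (pushforward ?U) B = 0"
          using emeasure_distr[OF measurable_eval_1[OF Ub] Bs] pre E(1)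
          by (simp add: emeasure_uniform_measure)
        then show "B \<in> null_sets (pushforward ?U)" using Bs by auto
      qed
      show "(\<lambda>z. z ^ p) \<in> measurable (pushforward \<mu>) (pushforward \<mu>)"
        "(\<lambda>z. z ^ q) \<in> measurable (pushforward \<mu>) (pushforward \<mu>)"
        using measurable_circle_power[OF c(1)] by auto
      show "distr (pushforward \<mu>) (pushforward \<mu>) (\<lambda>z. z ^ p) = pushforward \<mu>"
        "distr (pushforward \<mu>) (pushforward \<mu>) (\<lambda>z. z ^ q) = pushforward \<mu>"
        "distr (pushforward ?U) (pushforward ?U) (\<lambda>z. z ^ p) = pushforward ?U"
        "distr (pushforward ?U) (pushforward ?U) (\<lambda>z. z ^ q) = pushforward ?U"
        using pushforward_M_circle[OF M] pushforward_M_circle[OF U] by (simp_all only: M_circle_iff)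
      show "(z ^ q) ^ p = (z ^ p) ^ q" for z :: complex
        by (simp add: mult.commute flip: power_mult)
      show "measure (pushforward \<mu>) B \<in> {0, 1}" if "B \<in> sets (pushforward \<mu>)"
        "(\<lambda>z. z ^ p) -` B \<inter> space (pushforward \<mu>) = B" "(\<lambda>z. z ^ q) -` B \<inter> space (pushforward \<mu>) = B" for B
        using erg that borel_prob_measuresD(2)[OF c(1)]
        by (simp add: EM_circle_def ergodic_measures_def circle_def sets_borel_algebra)
    qed simp
    then have "?U = \<mu>" using pushforward_inj U M by (auto dest: inj_onD)
    moreover have "measure ?U E = 1"
      using measure_uniform_measure[of \<mu> E E] E(1) False by (simp add: emeasure_eq_measure)
    ultimately show ?thesis by simp
  qed simp
  then show ?thesis
    using M D by (simp add: EM_solenoid_def ergodic_measures_def M_solenoid_def solenoid_eq sets_borel_algebra)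
qed

lemma homeomorphic_map_restriction_map:
  "homeomorphic_map (subtopology (weak_star (solenoid p q)) (M_solenoid p q))
     (subtopology (weak_star circle) (M_circle p q)) (restriction_map p q)"
proof -
  let ?X = "subtopology (weak_star (solenoid p q)) (M_solenoid p q)"
  let ?Y = "subtopology (weak_star circle) (M_circle p q)"
  let ?R = "restriction_map p q"
  let ?G = "inv_into (M_solenoid p q) ?R"
  have sub: "M_solenoid p q \<subseteq> borel_prob_measures (solenoid p q)" "M_circle p q \<subseteq> borel_prob_measures circle"
    by (auto simp: M_solenoid_iff M_circle_iff solenoid_eq circle_def)
  have sp: "topspace ?X = M_solenoid p q" "topspace ?Y = M_circle p q" using sub by auto
  have inj: "inj_on ?R (M_solenoid p q)" and image: "?R ` M_solenoid p q = M_circle p q"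
    using pushforward_inj pushforward_image
    by (auto simp: restriction_map_eq_pushforward cong: inj_on_cong image_cong)
  have G: "?G \<nu> \<in> M_solenoid p q" "pushforward (?G \<nu>) = \<nu>" if "\<nu> \<in> M_circle p q" for \<nu>
    using that image inv_into_into[of \<nu> ?R] f_inv_into_f[of \<nu> ?R] restriction_map_eq_pushforward by metis+
  have "continuous_map ?X ?Y ?R"
  proof (unfold continuous_map_in_subtopology, intro conjI continuous_map_into_weak_star)
    show "?R \<in> topspace ?X \<rightarrow> M_circle p q" using image sp by auto
    then show "?R \<mu> \<in> borel_prob_measures circle" if "\<mu> \<in> topspace ?X" for \<mu> using that sub by auto
    fix f assume f: "f \<in> cont_functions circle"
    then have fc: "continuous_on circ f" by (simp add: circle_def cont_functions_top_of_set)
    have "continuous_map ?X euclidean (\<lambda>\<mu>. \<integral>\<phi>. f (\<phi> 1) \<partial>\<mu>)"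
      using continuous_on_comp_proj[OF fc, of 0]
      by (intro continuous_map_from_subtopology continuous_map_weak_star_integral)
         (simp add: solenoid_eq cont_functions_top_of_set)
    then show "continuous_map ?X euclidean (\<lambda>\<mu>. integral\<^sup>L (?R \<mu>) f)"
      by (rule continuous_map_eq)
         (use sp fc in \<open>auto simp: restriction_map_eq_pushforward integral_pushforward M_solenoid_iff\<close>)
  qed
  moreover have "continuous_map ?Y ?X ?G"
  proof (unfold continuous_map_in_subtopology, intro conjI continuous_map_into_weak_star)
    show "?G \<in> topspace ?Y \<rightarrow> M_solenoid p q" using G sp by auto
    then show "?G \<nu> \<in> borel_prob_measures (solenoid p q)" if "\<nu> \<in> topspace ?Y" for \<nu>
      using that sub by auto
    fix f assume "f \<in> cont_functions (solenoid p q)"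
    then have f: "continuous_on Sol f" by (simp add: solenoid_eq cont_functions_top_of_set)
    \<comment> \<open>The function \<open>h\<close> is chosen before \<open>\<nu>\<close>. The
      approximation is uniform over the solenoid and every coordinate of \<open>?G \<nu>\<close> has
      law \<open>\<nu>\<close>, so one \<open>h\<close> serves all measures.\<close>
    have "\<exists>h. continuous_on circ h \<and> (\<forall>\<nu>\<in>M_circle p q.
      dist (integral\<^sup>L \<nu> h) (integral\<^sup>L (?G \<nu>) f) < e)" if e: "e > 0" for e
    proof -
      obtain n h where h: "continuous_on circ h" "\<And>\<phi>. \<phi> \<in> Sol \<Longrightarrow> dist (f \<phi>) (h (proj n \<phi>)) < e / 2"
        using Stone_Weierstrass_solenoid[OF f half_gt_zero[OF e]] by blast
      have "dist (integral\<^sup>L \<nu> h) (integral\<^sup>L (?G \<nu>) f) < e" if \<nu>: "\<nu> \<in> M_circle p q" for \<nu>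
      proof -
        have g: "?G \<nu> \<in> borel_prob_measures (top_of_set Sol)"
          using G(1)[OF \<nu>] by (simp add: M_solenoid_iff)
        have "integral\<^sup>L \<nu> h = (\<integral>\<phi>. h (proj n \<phi>) \<partial>?G \<nu>)"
          using integral_pushforward[OF g h(1)] integral_comp_proj[OF G(1)[OF \<nu>] h(1), of n]
            G(2)[OF \<nu>] by simp
        moreover have "dist (integral\<^sup>L (?G \<nu>) f) (\<integral>\<phi>. h (proj n \<phi>) \<partial>?G \<nu>) \<le> e / 2"
          using h(2) by (intro borel_prob_integral_dist_le[OF compact_Sol g f]
              continuous_on_comp_proj[OF h(1)]) (auto intro: less_imp_le)
        ultimately show ?thesis using e by (simp add: dist_commute)
      qed
      with h(1) show ?thesis by blast
    qed
    \<comment> \<open>The denominator \<open>Suc k\<close> keeps the bound positive at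
      \<open>k = 0\<close>.\<close>
    then have "\<forall>k :: nat. \<exists>h. continuous_on circ h \<and> (\<forall>\<nu>\<in>M_circle p q.
      dist (integral\<^sup>L \<nu> h) (integral\<^sup>L (?G \<nu>) f) < 1 / Suc k)" by simp
    then obtain h where h: "\<And>k :: nat. continuous_on circ (h k)"
      "\<And>k \<nu>. \<nu> \<in> M_circle p q \<Longrightarrow> dist (integral\<^sup>L \<nu> (h k)) (integral\<^sup>L (?G \<nu>) f) < 1 / Suc k"
      by metis
    \<comment> \<open>A uniform limit of the weak-star continuous functionals that integrate
      \<open>h k\<close> against \<open>\<nu>\<close>.\<close>
    have "continuous_map ?Y Met_TC.mtopology (\<lambda>\<nu>. integral\<^sup>L (?G \<nu>) f)"
    proof (rule Met_TC.continuous_map_uniform_limit[OF always_eventually])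
      show "\<forall>k. continuous_map ?Y Met_TC.mtopology (\<lambda>\<nu>. integral\<^sup>L \<nu> (h k))"
        using h(1) by (auto intro!: continuous_map_from_subtopology continuous_map_weak_star_integral
            simp: circle_def cont_functions_top_of_set)
      fix e :: real assume "e > 0"
      then obtain N where N: "1 / Suc N < e" using nat_approx_posE by blast
      have "dist (integral\<^sup>L \<nu> (h k)) (integral\<^sup>L (?G \<nu>) f) < e"
        if "k \<ge> N" "\<nu> \<in> M_circle p q" for k \<nu>
      proof -
        have "1 / real (Suc k) \<le> 1 / real (Suc N)" using that(1) by (simp add: frac_le)
        with h(2)[OF that(2), of k] N show ?thesis by linarith
      qed
      then show "\<forall>\<^sub>F k in sequentially. \<forall>\<nu>\<in>topspace ?Y. integral\<^sup>L (?G \<nu>) f \<in> UNIV \<and>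
          dist (integral\<^sup>L \<nu> (h k)) (integral\<^sup>L (?G \<nu>) f) < e"
        using sp by (auto simp: eventually_sequentially)
    qed simp
    then show "continuous_map ?Y euclidean (\<lambda>\<nu>. integral\<^sup>L (?G \<nu>) f)" by simp
  qed
  ultimately have "homeomorphic_maps ?X ?Y ?R ?G"
    unfolding homeomorphic_maps_def sp
    using inj image by (auto simp: inv_into_f_f f_inv_into_f)
  then show ?thesis by (rule homeomorphic_maps_imp_map)
qed

text \<open>Within the invariant measures, a measure is ergodic exactly when its image is. The
  homeomorphism therefore matches the two ergodic subsets, and no second continuity argument is
  required.\<close>

lemma homeomorphic_map_restriction_map_ergodic:
  "homeomorphic_map (subtopology (weak_star (solenoid p q)) (EM_solenoid p q))
     (subtopology (weak_star circle) (EM_circle p q)) (restriction_map p q)"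
proof -
  have sub: "EM_solenoid p q \<subseteq> M_solenoid p q" "EM_circle p q \<subseteq> M_circle p q"
    by (auto simp: EM_solenoid_def M_solenoid_def EM_circle_def M_circle_def ergodic_measures_def)
  have "homeomorphic_map
     (subtopology (subtopology (weak_star (solenoid p q)) (M_solenoid p q)) (EM_solenoid p q))
     (subtopology (subtopology (weak_star circle) (M_circle p q)) (EM_circle p q)) (restriction_map p q)"
    by (rule homeomorphic_map_subtopologies_alt[OF homeomorphic_map_restriction_map])
       (use ergodic_pushforward pushforward_ergodicD in \<open>auto simp: restriction_map_eq_pushforward\<close>)
  then show ?thesis using sub by (simp add: subtopology_subtopology Int_absorb1)
qed

end

theorem proposition4p1:
  fixes p q :: nat
  assumes "p > 1" and "q > 1"
    and "ln (real p) / ln (real q) \<notin> \<rat>"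
  shows "(\<forall>\<mu>\<in>M_solenoid p q. restriction_map p q \<mu> \<in> M_circle p q \<and>
            (\<forall>f\<in>cont_functions circle.
               integral\<^sup>L (restriction_map p q \<mu>) f = integral\<^sup>L \<mu> (cont_embed f))) \<and>
         homeomorphic_map
           (subtopology (weak_star (solenoid p q)) (M_solenoid p q))
           (subtopology (weak_star circle) (M_circle p q))
           (restriction_map p q) \<and>
         homeomorphic_map
           (subtopology (weak_star (solenoid p q)) (EM_solenoid p q))
           (subtopology (weak_star circle) (EM_circle p q))
           (restriction_map p q)"
proof -
  interpret solenoid_dual p q using assms by unfold_locales
  have "integral\<^sup>L (restriction_map p q \<mu>) f = integral\<^sup>L \<mu> (cont_embed f)"
    if "\<mu> \<in> M_solenoid p q" "f \<in> cont_functions circle" for \<mu> f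
    using that integral_pushforward[of \<mu> f]
    by (simp add: restriction_map_eq_pushforward M_solenoid_iff cont_embed_def circle_def
        cont_functions_top_of_set)
  then show ?thesis
    using homeomorphic_map_restriction_map homeomorphic_map_restriction_map_ergodic
    by (auto simp: restriction_map_eq_pushforward pushforward_M_circle)
qed

end
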